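(* Every polynomial of degree three in $\mathbb{R}[x,y]$ is equivalent with respect to $\approx$ to some polynomial in the list $\mathcal{L}$. Moreover, the polynomials in $\mathcal{L}$ are pairwise inequivalent with respect to $\approx$ (i.e. no two distinct polynomials in $\mathcal{L}$ are equivalent with respect to $\approx$).
   Context: $\mathrm{Aut}\,\mathbb{R}[x,y]$ denotes the group of all ring automorphisms of $\mathbb{R}[x,y]$. For $f,g\in\mathbb{R}[x,y]$, write $f\approx g$ if there exist $\varphi\in\mathrm{Aut}\,\mathbb{R}[x,y]$ and $c\in\mathbb{R}^{\times}$ such that $\varphi(f)=cg$. The list $\mathcal{L}=\mathcal{L}_1\cup\mathcal{L}_2\cup\mathcal{L}_3\cup\mathcal{L}_4$ consists of the following polynomials (each sign $\pm$ gives two families). $\mathcal{L}_1$ (canonical form $x^3+xy^2$): $x^3+xy^2+x^2+Hx+Iy+J$ with $H,J\in\mathbb{R}$, $I\ge 0$; $x^3+xy^2+y+Hx+J$ with $H\in\mathbb{R}$, $J\ge 0$; $x^3+xy^2\pm x+J$ with $J\ge 0$; $x^3+xy^2+1$; $x^3+xy^2$. $\mathcal{L}_2$ (canonical form $x^3-xy^2$): $x^3-xy^2-y^2+Hx+Iy+J$ with $J\in\mathbb{R}$, $I\ge 0$, $H+I\le -\frac{3}{4}$; $x^3-xy^2-y+Hx+J$ with $J\ge 0$, $H\in[-1,1]$; $x^3-xy^2+1$; $x^3-xy^2$. $\mathcal{L}_3$ (canonical form $x^2y$): $x^2y+y^2-x+Iy+J$ with $I,J\in\mathbb{R}$; $x^2y+y^2\pm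 y+J$ with $J\in\mathbb{R}$; $x^2y+y^2\pm 1$; $x^2y+y^2$; $x^2y-x\pm y+J$ with $J\ge 0$; $x^2y\pm y+1$; $x^2y\pm y$; $x^2y-x+1$; $x^2y-x$; $x^2y-1$; $x^2y$. $\mathcal{L}_4$ (canonical form $x^3$): $x^3-y^2\pm x+J$ with $J\in\mathbb{R}$; $x^3-y^2\pm 1$; $x^3-y^2$; $x^3-y$; $x^3-xy+1$; $x^3-xy$; $x^3\pm x+J$ with $J\ge 0$; $x^3+1$; $x^3$. *)

theory Defs
  imports Complex_Main "HOL-Computational_Algebra.Polynomial"
begin

text \<open>
  The ring \<open>\<real>[x,y]\<close> is represented as \<open>\<real>[x][y]\<close>: the coefficient of
  \<open>x\<^sup>i y\<^sup>j\<close> in \<open>f\<close> is \<open>coeff (coeff f j) i\<close>.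
\<close>

type_synonym bipoly = "real poly poly"

definition cst :: "real \<Rightarrow> bipoly" where
  "cst a = [:[:a:]:]"

definition vx :: bipoly where
  "vx = [:[:0, 1:]:]"

definition vy :: bipoly where
  "vy = [:0, 1:]"

text \<open>The inserted \<open>0\<close> only matters for the zero polynomial, which gets degree \<open>0\<close>.\<close>

definition total_degree :: "bipoly \<Rightarrow> nat" where
  "total_degree f = Max (insert 0 {i + j | i j. coeff (coeff f j) i \<noteq> 0})"

text \<open>Automorphisms are not required to be \<open>\<real>\<close>-linear.\<close>

definition ring_automorphisms :: "('a::ring_1 \<Rightarrow> 'a) set" where
  "ring_automorphisms =
     {\<phi>. bij \<phi> \<and> (\<forall>f g. \<phi> (f + g) = \<phi> f + \<phi> g) \<and> (\<forall>f g. \<phi> (f * g) = \<phi> f * \<phi> g) \<and> \<phi> 1 = 1}"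

definition aut_equiv :: "bipoly \<Rightarrow> bipoly \<Rightarrow> bool" where
  "aut_equiv f g \<longleftrightarrow> (\<exists>\<phi>\<in>ring_automorphisms. \<exists>c::real. c \<noteq> 0 \<and> \<phi> f = cst c * g)"

definition list_L1 :: "bipoly set" where
  "list_L1 =
     {vx^3 + vx * vy^2 + vx^2 + cst H * vx + cst I * vy + cst J | H I J. I \<ge> 0} \<union>
     {vx^3 + vx * vy^2 + vy + cst H * vx + cst J | H J. J \<ge> 0} \<union>
     {vx^3 + vx * vy^2 + vx + cst J | J. J \<ge> 0} \<union>
     {vx^3 + vx * vy^2 - vx + cst J | J. J \<ge> 0} \<union>
     {vx^3 + vx * vy^2 + 1,
      vx^3 + vx * vy^2}"

definition list_L2 :: "bipoly set" where
  "list_L2 =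
     {vx^3 - vx * vy^2 - vy^2 + cst H * vx + cst I * vy + cst J | H I J.
        I \<ge> 0 \<and> H + I \<le> - 3 / 4} \<union>
     {vx^3 - vx * vy^2 - vy + cst H * vx + cst J | H J. J \<ge> 0 \<and> H \<in> {-1..1}} \<union>
     {vx^3 - vx * vy^2 + 1,
      vx^3 - vx * vy^2}"

definition list_L3 :: "bipoly set" where
  "list_L3 =
     {vx^2 * vy + vy^2 - vx + cst I * vy + cst J | I J. True} \<union>
     {vx^2 * vy + vy^2 + vy + cst J | J. True} \<union>
     {vx^2 * vy + vy^2 - vy + cst J | J. True} \<union>
     {vx^2 * vy + vy^2 + 1,
      vx^2 * vy + vy^2 - 1,
      vx^2 * vy + vy^2} \<union>
     {vx^2 * vy - vx + vy + cst J | J. J \<ge> 0} \<union>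
     {vx^2 * vy - vx - vy + cst J | J. J \<ge> 0} \<union>
     {vx^2 * vy + vy + 1,
      vx^2 * vy - vy + 1,
      vx^2 * vy + vy,
      vx^2 * vy - vy,
      vx^2 * vy - vx + 1,
      vx^2 * vy - vx,
      vx^2 * vy - 1,
      vx^2 * vy}"

definition list_L4 :: "bipoly set" where
  "list_L4 =
     {vx^3 - vy^2 + vx + cst J | J. True} \<union>
     {vx^3 - vy^2 - vx + cst J | J. True} \<union>
     {vx^3 - vy^2 + 1,
      vx^3 - vy^2 - 1,
      vx^3 - vy^2,
      vx^3 - vy,
      vx^3 - vx * vy + 1,
      vx^3 - vx * vy} \<union>
     {vx^3 + vx + cst J | J. J \<ge> 0} \<union>
     {vx^3 - vx + cst J | J. J \<ge> 0} \<union>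
     {vx^3 + 1,
      vx^3}"

definition list_L :: "bipoly set" where
  "list_L = list_L1 \<union> list_L2 \<union> list_L3 \<union> list_L4"

end

theory Submission
  imports Defs
begin

text \<open>
  Automorphisms fix the real constants, since these are the units together with \<open>0\<close> and \<open>\<real>\<close> has no
  nontrivial ring endomorphism. So \<open>\<phi> f = c g\<close> reads \<open>f(P, Q) = c g\<close> with \<open>P = \<phi> x\<close> and \<open>Q = \<phi> y\<close>.
  No structure theorem for the automorphism group is needed: if \<open>f\<close> and \<open>g\<close> are cubics, counting degrees
  in \<open>f(P, Q)\<close> forces \<open>P\<close> and \<open>Q\<close> to be affine, up to the symmetry \<open>y \<mapsto> - x\<^sup>2 - y - I\<close> of
  \<open>x\<^sup>2y + y\<^sup>2 + Hx + Iy + J\<close>, unless the cubic form of \<open>f\<close> is a cube. Among the latter, a Weierstrass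
  cubic could only escape through \<open>deg P = 2k\<close>, \<open>deg Q = 3k\<close>, which the Jacobian bracket excludes;
  a univariate cubic forces \<open>P\<close> to be affine; and \<open>x\<^sup>3 - y\<close>, \<open>x\<^sup>3 - xy + 1\<close>, \<open>x\<^sup>3 - xy\<close> are told apart by
  reducibility. Affine equivalences are then compared coefficientwise, and affine changes of
  coordinates also suffice to reach a normal form.
\<close>

section \<open>Evaluation and automorphisms\<close>

text \<open>Polynomial identities are checked through their values at real points, which determine
  them; an automorphism then acts by substituting two polynomials. The obstacle in every degree
  count is cancellation of leading forms. It cannot happen in x^2 + y^2 over the reals; of x, x - y,
  x + y at most one can lose degree; and y (x^2 + y + I) has to be kept factored for its degree to
  be exact. The signs and inequalities of the list come from weights. An affine equivalence must
  respect the linear factors of the cubic form. Apart from the symmetries that permute the three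
  lines of x^3 - xy^2, this mostly leaves a diagonal scaling, which multiplies each remaining
  coefficient by a monomial in the scaling factors. A coefficient whose multiplier is always
  positive keeps its sign, which explains the signs \<plusminus> in the list; one whose multiplier
  can be negative can be made nonnegative.\<close>

definition ev :: "bipoly \<Rightarrow> real \<Rightarrow> real \<Rightarrow> real" where
  "ev f x y = poly (poly f [:y:]) x"

lemma ev_simps [simp]:
  "ev 0 x y = 0" "ev 1 x y = 1" "ev (numeral k) x y = numeral k"
  "ev (cst a) x y = a" "ev vx x y = x" "ev vy x y = y"
  "ev (f + g) x y = ev f x y + ev g x y" "ev (f - g) x y = ev f x y - ev g x y"
  "ev (- f) x y = - ev f x y" "ev (f * g) x y = ev f x y * ev g x y"
  "ev (f ^ n) x y = ev f x y ^ n"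
  by (simp_all add: ev_def cst_def vx_def vy_def)

lemma ev_sum [simp]: "ev (sum F A) x y = (\<Sum>i\<in>A. ev (F i) x y)"
  by (simp add: ev_def poly_sum)

text \<open>For fixed \<open>y\<close> both specializations agree at all real \<open>x\<close>,
  hence as polynomials in \<open>x\<close>. So \<open>f - g\<close>, a polynomial over the domain
  R[x], has the infinitely many roots \<open>[:y:]\<close>.\<close>

lemma bipoly_eqI:
  assumes "\<And>x y. ev f x y = ev g x y"
  shows "f = g"
proof -
  have "poly (f - g) [:y:] = 0" for y
    using assms by (auto simp: ev_def poly_eq_poly_eq_iff[symmetric])
  then have "range (\<lambda>y. [:y:]) \<subseteq> {p. poly (f - g) p = 0}" by auto
  moreover have "infinite (range (\<lambda>y::real. [:y:]))"
    using finite_imageD[of "\<lambda>y::real. [:y:]" UNIV] infinite_UNIV_char_0 by (auto simp: inj_on_def)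
  ultimately have "infinite {p. poly (f - g) p = 0}" using finite_subset by blast
  then have "f - g = 0" using poly_roots_finite by blast
  then show ?thesis by simp
qed

lemma ev_altdef: "ev f x y = (\<Sum>j\<le>degree f. \<Sum>i\<le>degree (coeff f j). coeff (coeff f j) i * x ^ i * y ^ j)"
proof -
  have "poly f [:y:] = (\<Sum>j\<le>degree f. coeff f j * [:y ^ j:])"
    by (simp add: poly_altdef poly_const_pow)
  then have "ev f x y = (\<Sum>j\<le>degree f. poly (coeff f j) x * y ^ j)"
    by (simp add: ev_def poly_sum mult.commute)
  then show ?thesis by (simp add: poly_altdef sum_distrib_right sum_distrib_left mult_ac)
qed

definition subst :: "bipoly \<Rightarrow> bipoly \<Rightarrow> bipoly \<Rightarrow> bipoly" where
  "subst P Q f = (\<Sum>j\<le>degree f. \<Sum>i\<le>degree (coeff f j). cst (coeff (coeff f j) i) * P ^ i * Q ^ j)"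

lemma ev_subst [simp]: "ev (subst P Q f) x y = ev f (ev P x y) (ev Q x y)"
  by (simp add: subst_def ev_altdef[of f])

text \<open>Constants and the two variables generate the ring: \<open>f\<close> equals
  \<open>subst vx vy f\<close>, which is built from them by sums, products and powers.\<close>

lemma bipoly_induct [case_names cst vx vy add mult]:
  assumes "\<And>a. R (cst a)" "R vx" "R vy"
    and add: "\<And>f g. R f \<Longrightarrow> R g \<Longrightarrow> R (f + g)"
    and mult: "\<And>f g. R f \<Longrightarrow> R g \<Longrightarrow> R (f * g)"
  shows "R f"
proof -
  have sum: "R (sum F A)" if "finite A" "\<And>i. i \<in> A \<Longrightarrow> R (F i)" for F :: "nat \<Rightarrow> bipoly" and A
    using that
  proof (induction A rule: finite_induct)
    case empty
    show ?case using assms(1)[of 0] by (simp add: cst_def)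
  qed (auto intro: add)
  have pow: "R (g ^ n)" if "R g" for g n
  proof (induction n)
    case 0
    show ?case using assms(1)[of 1] by (simp add: cst_def one_pCons)
  qed (auto intro: mult that)
  have "f = subst vx vy f" by (rule bipoly_eqI) simp
  moreover have "R (subst vx vy f)"
    unfolding subst_def by (intro sum mult pow assms) auto
  ultimately show ?thesis by simp
qed

lemma cst_simps: "cst (a + b) = cst a + cst b" "cst (a - b) = cst a - cst b" "cst (a * b) = cst a * cst b"
  "cst (a ^ n) = cst a ^ n" "cst (- a) = - cst a" "cst 1 = 1" "cst 0 = 0"
  by (rule bipoly_eqI; simp)+

lemma cst_inject [simp]: "cst a = cst b \<longleftrightarrow> a = b"
  by (simp add: cst_def)

text \<open>Nonnegative reals are squares, so \<open>\<sigma>\<close> is monotone. It fixes the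
  rationals, and a rational strictly between \<open>a\<close> and \<open>\<sigma> a\<close> would
  contradict monotonicity.\<close>

lemma real_ring_hom_id:
  fixes \<sigma> :: "real \<Rightarrow> real"
  assumes add: "\<And>a b. \<sigma> (a + b) = \<sigma> a + \<sigma> b" and mult: "\<And>a b. \<sigma> (a * b) = \<sigma> a * \<sigma> b"
    and one: "\<sigma> 1 = 1"
  shows "\<sigma> a = a"
proof -
  have zero: "\<sigma> 0 = 0" using add[of 0 0] by simp
  have diff: "\<sigma> (a - b) = \<sigma> a - \<sigma> b" for a b using add[of "a - b" b] by simp
  have nat: "\<sigma> (of_nat n) = of_nat n" for n by (induction n) (auto simp: zero add one)
  have int: "\<sigma> (of_int n) = of_int n" for n
    by (cases n rule: int_diff_cases) (simp add: diff nat)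
  have rat: "\<sigma> q = q" if rational: "q \<in> \<rat>" for q
  proof -
    obtain m n where q: "q = of_int m / of_int n" "n \<noteq> 0" using rational unfolding Rats_eq_int_div_int by blast
    then have qn: "q * of_int n = of_int m" by simp
    then have "\<sigma> q * of_int n = of_int m" using mult[of q "of_int n"] int by simp
    then show ?thesis using qn q(2) by (metis mult_right_cancel of_int_eq_0_iff)
  qed
  have nonneg: "\<sigma> a \<ge> 0" if "a \<ge> 0" for a
    using mult[of "sqrt a" "sqrt a"] that by simp
  have mono: "\<sigma> a \<le> \<sigma> b" if "a \<le> b" for a b
    using nonneg[of "b - a"] diff[of b a] that by simp
  show ?thesis
  proof (rule antisym; rule ccontr)
    assume "\<not> \<sigma> a \<le> a"
    then obtain q where "q \<in> \<rat>" "a < q" "q < \<sigma> a" using Rats_dense_in_real[of a "\<sigma> a"] by auto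
    then show False using mono[of a q] rat by force
  next
    assume "\<not> a \<le> \<sigma> a"
    then obtain q where "q \<in> \<rat>" "\<sigma> a < q" "q < a" using Rats_dense_in_real[of "\<sigma> a" a] by auto
    then show False using mono[of q a] rat by force
  qed
qed

lemma bipoly_unit_cst:
  assumes "(f::bipoly) * g = 1"
  obtains a where "f = cst a"
proof -
  have nz: "f \<noteq> 0" "g \<noteq> 0" using assms by auto
  then have "degree f + degree g = 0" using assms by (metis degree_1 degree_mult_eq)
  then obtain p q where pq: "f = [:p:]" "g = [:q:]" by (metis add_is_0 degree_eq_zeroE)
  then have "p * q = 1" using assms by (simp add: one_pCons mult.commute)
  moreover from this have "p \<noteq> 0" "q \<noteq> 0" by auto
  ultimately have "degree p + degree q = 0" by (metis degree_1 degree_mult_eq)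
  then obtain a where "p = [:a:]" by (metis add_is_0 degree_eq_zeroE)
  then show ?thesis using pq that by (simp add: cst_def)
qed

section \<open>Automorphisms as substitutions, and the equivalence relation\<close>

lemma ring_automorphismsD:
  assumes "\<phi> \<in> ring_automorphisms"
  shows aut_add: "\<phi> (f + g) = \<phi> f + \<phi> g" and aut_mult: "\<phi> (f * g) = \<phi> f * \<phi> g"
    and aut_one: "\<phi> 1 = 1" and aut_inj: "\<phi> f = \<phi> g \<longleftrightarrow> f = g" and aut_surj: "\<exists>h. \<phi> h = g"
proof -
  have "bij \<phi>" using assms by (simp add: ring_automorphisms_def)
  then show "\<phi> f = \<phi> g \<longleftrightarrow> f = g" "\<exists>h. \<phi> h = g"
    by (auto simp: bij_def inj_eq surj_def) metis
qed (use assms in \<open>auto simp: ring_automorphisms_def\<close>)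

lemma aut_cst:
  fixes \<phi> :: "bipoly \<Rightarrow> bipoly"
  assumes \<phi>: "\<phi> \<in> ring_automorphisms"
  shows "\<phi> (cst a) = cst a"
proof -
  have zero: "\<phi> 0 = 0" using aut_add[OF \<phi>, of 0 0] by simp
  have "\<exists>b. \<phi> (cst a) = cst b" for a
  proof (cases "a = 0")
    case True
    then show ?thesis using zero by (metis cst_simps(7))
  next
    case False
    then have "cst a * cst (inverse a) = 1" by (simp add: cst_simps(3)[symmetric] cst_simps)
    then have "\<phi> (cst a) * \<phi> (cst (inverse a)) = 1"
      by (simp add: aut_mult[OF \<phi>, symmetric] aut_one[OF \<phi>])
    then show ?thesis using bipoly_unit_cst by metis
  qed
  then obtain \<sigma> where \<sigma>: "\<And>a. \<phi> (cst a) = cst (\<sigma> a)" by metis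
  have "\<sigma> a = a" for a
  proof (rule real_ring_hom_id)
    show "\<sigma> (a + b) = \<sigma> a + \<sigma> b" for a b
      using aut_add[OF \<phi>, of "cst a" "cst b"] by (simp add: \<sigma> cst_simps(1)[symmetric])
    show "\<sigma> (a * b) = \<sigma> a * \<sigma> b" for a b
      using aut_mult[OF \<phi>, of "cst a" "cst b"] by (simp add: \<sigma> cst_simps(3)[symmetric])
    show "\<sigma> 1 = 1" using \<sigma>[of 1] aut_one[OF \<phi>] by (simp add: cst_simps(6)) (metis cst_inject cst_simps(6))
  qed
  then show ?thesis using \<sigma> by simp
qed

lemma ev_aut:
  assumes \<phi>: "\<phi> \<in> ring_automorphisms"
  shows "ev (\<phi> f) x y = ev f (ev (\<phi> vx) x y) (ev (\<phi> vy) x y)"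
  by (induction f rule: bipoly_induct) (simp_all add: aut_cst[OF \<phi>] aut_add[OF \<phi>] aut_mult[OF \<phi>])

lemma subst_ring_automorphism:
  assumes "\<And>x y. ev P (ev P' x y) (ev Q' x y) = x" "\<And>x y. ev Q (ev P' x y) (ev Q' x y) = y"
    "\<And>x y. ev P' (ev P x y) (ev Q x y) = x" "\<And>x y. ev Q' (ev P x y) (ev Q x y) = y"
  shows "subst P Q \<in> ring_automorphisms"
proof -
  have "subst P Q (subst P' Q' f) = f" "subst P' Q' (subst P Q f) = f" for f
    by (rule bipoly_eqI; simp add: assms)+
  then have "bij (subst P Q)" by (metis bijI')
  moreover have "subst P Q (f + g) = subst P Q f + subst P Q g"
    "subst P Q (f * g) = subst P Q f * subst P Q g" "subst P Q 1 = 1" for f g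
    by (rule bipoly_eqI; simp)+
  ultimately show ?thesis by (simp add: ring_automorphisms_def)
qed

lemma ring_automorphisms_comp:
  "\<phi> \<in> ring_automorphisms \<Longrightarrow> \<psi> \<in> ring_automorphisms \<Longrightarrow> \<phi> \<circ> \<psi> \<in> ring_automorphisms"
  by (auto simp: ring_automorphisms_def intro: bij_comp)

lemma ring_automorphisms_inv:
  assumes "\<phi> \<in> ring_automorphisms"
  shows "inv \<phi> \<in> ring_automorphisms"
proof -
  have b: "bij \<phi>" using assms by (simp add: ring_automorphisms_def)
  have r: "\<phi> (inv \<phi> f) = f" for f using b by (simp add: bij_def surj_f_inv_f)
  have "inv \<phi> (f + g) = inv \<phi> f + inv \<phi> g" "inv \<phi> (f * g) = inv \<phi> f * inv \<phi> g" "inv \<phi> 1 = 1" for f g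
    using aut_inj[OF assms] aut_add[OF assms] aut_mult[OF assms] aut_one[OF assms] r by metis+
  then show ?thesis using b by (simp add: ring_automorphisms_def bij_imp_bij_inv)
qed

lemma aut_equiv_trans:
  assumes "aut_equiv f g" "aut_equiv g h"
  shows "aut_equiv f h"
proof -
  obtain \<phi> \<psi> c d where *: "\<phi> \<in> ring_automorphisms" "\<psi> \<in> ring_automorphisms" "c \<noteq> 0" "d \<noteq> 0"
    "\<phi> f = cst c * g" "\<psi> g = cst d * h"
    using assms by (auto simp: aut_equiv_def)
  then have "(\<psi> \<circ> \<phi>) f = cst (c * d) * h"
    by (simp add: aut_mult[OF *(2)] aut_cst[OF *(2)] cst_simps)
  then show ?thesis using * ring_automorphisms_comp[OF *(2,1)] unfolding aut_equiv_def
    by (metis mult_eq_0_iff)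
qed

lemma aut_equiv_sym:
  assumes "aut_equiv f g"
  shows "aut_equiv g f"
proof -
  obtain \<phi> c where *: "\<phi> \<in> ring_automorphisms" "c \<noteq> 0" "\<phi> f = cst c * g"
    using assms by (auto simp: aut_equiv_def)
  have i: "inv \<phi> \<in> ring_automorphisms" using * by (simp add: ring_automorphisms_inv)
  have b: "bij \<phi>" using * by (simp add: ring_automorphisms_def)
  have "f = inv \<phi> (cst c * g)" using b *(3) by (metis bij_inv_eq_iff)
  then have "f = cst c * inv \<phi> g" by (simp add: aut_mult[OF i] aut_cst[OF i])
  then have "inv \<phi> g = cst (inverse c) * f"
    using * by (simp add: mult.assoc[symmetric] cst_simps(3)[symmetric] cst_simps(6))
  then show ?thesis unfolding aut_equiv_def using i * by (metis inverse_zero_imp_zero)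
qed

definition affine :: "real \<Rightarrow> real \<Rightarrow> real \<Rightarrow> bipoly" where
  "affine a b p = cst a * vx + cst b * vy + cst p"

lemma ev_affine [simp]: "ev (affine a b p) x y = a * x + b * y + p"
  by (simp add: affine_def)

lemma aut_equivI_affine:
  assumes det: "a * e \<noteq> b * d" and "c \<noteq> 0"
    and eq: "\<And>x y. ev f (a * x + b * y + p) (d * x + e * y + q) = c * ev g x y"
  shows "aut_equiv f g"
proof -
  define D where "D = a * e - b * d"
  have D: "D \<noteq> 0" using det by (simp add: D_def)
  let ?P = "affine a b p" and ?Q = "affine d e q"
  \<comment> \<open>The inverse affine map, by Cramer's rule.\<close>
  let ?P' = "affine (e / D) (- b / D) ((b * q - e * p) / D)"
  let ?Q' = "affine (- d / D) (a / D) ((d * p - a * q) / D)"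
  have "subst ?P ?Q \<in> ring_automorphisms"
    by (rule subst_ring_automorphism[of _ ?P' ?Q']) (use D in \<open>simp_all add: field_simps\<close>, simp_all add: D_def algebra_simps)
  moreover have "subst ?P ?Q f = cst c * g" by (rule bipoly_eqI) (simp add: eq)
  ultimately show ?thesis using \<open>c \<noteq> 0\<close> unfolding aut_equiv_def by blast
qed

section \<open>Total degree\<close>

text \<open>
  \<open>homog f\<close> is \<open>f(t, z t)\<close> in \<open>\<real>[z][t]\<close>: the total degree becomes a degree in \<open>t\<close>, and the leading
  coefficient is the dehomogenized leading form.
\<close>

definition homog :: "bipoly \<Rightarrow> bipoly" where
  "homog = subst vy (vx * vy)"

lemma coeff_homog: "coeff (coeff (homog f) n) j = (if j \<le> n then coeff (coeff f j) (n - j) else 0)"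
proof -
  \<comment> \<open>x^i y^k becomes z^k t^(i+k), so the outer exponent records the total
    degree.\<close>
  have monom: "cst a * vy ^ i * (vx * vy) ^ k = monom (monom a k) (i + k)" for a i k
    by (rule bipoly_eqI) (simp add: ev_def poly_monom cst_def vx_def vy_def poly_const_pow power_add
        power_mult_distrib)
  have "coeff (coeff (homog f) n) j =
      (\<Sum>k\<le>degree f. \<Sum>i\<le>degree (coeff f k). if k = j \<and> i + k = n then coeff (coeff f k) i else 0)"
    unfolding homog_def subst_def monom coeff_sum
    by (intro sum.cong refl) auto
  also have "\<dots> = (\<Sum>k\<le>degree f. if k = j then
      (\<Sum>i\<le>degree (coeff f k). if i + k = n then coeff (coeff f k) i else 0) else 0)"
    by (intro sum.cong refl) auto
  also have "\<dots> = (if j \<le> degree f then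
      (\<Sum>i\<le>degree (coeff f j). if i + j = n then coeff (coeff f j) i else 0) else 0)"
    by (simp add: sum.delta)
  also have "\<dots> = (\<Sum>i\<le>degree (coeff f j). if i + j = n then coeff (coeff f j) i else 0)"
    by (auto simp: coeff_eq_0 intro!: sum.neutral)
  also have "\<dots> = (if j \<le> n then coeff (coeff f j) (n - j) else 0)"
  proof (cases "j \<le> n")
    case True
    then have "i + j = n \<longleftrightarrow> i = n - j" for i by auto
    then show ?thesis using True by (simp add: sum.delta coeff_eq_0)
  qed (auto intro!: sum.neutral)
  finally show ?thesis .
qed

lemma homog_hom: "homog (f + g) = homog f + homog g" "homog (f - g) = homog f - homog g"
  "homog (f * g) = homog f * homog g" "homog (f ^ n) = homog f ^ n" "homog (- f) = - homog f"
  "homog (cst a) = cst a" "homog 0 = 0"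
  unfolding homog_def by (rule bipoly_eqI; simp)+

lemma coeff_homog_neq_0: "coeff (coeff f j) i \<noteq> 0 \<Longrightarrow> i + j \<le> degree (homog f)"
  using coeff_homog[of f "i + j" j] by (intro le_degree) auto

lemma homog_eq_0_iff [simp]: "homog f = 0 \<longleftrightarrow> f = 0"
proof
  assume "homog f = 0"
  then have "coeff (coeff f j) i = 0" for i j
    using coeff_homog[of f "i + j" j] by simp
  then show "f = 0" by (simp add: poly_eq_iff)
qed (simp add: homog_hom)

lemma total_degree_eq_degree_homog: "total_degree f = degree (homog f)"
proof -
  let ?S = "insert 0 {i + j | i j. coeff (coeff f j) i \<noteq> 0}"
  have sub: "?S \<subseteq> {..degree (homog f)}" using coeff_homog_neq_0 by auto
  have "degree (homog f) \<in> ?S"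
  proof (cases "f = 0")
    case False
    then have "coeff (homog f) (degree (homog f)) \<noteq> 0" by simp
    then obtain j where "coeff (coeff (homog f) (degree (homog f))) j \<noteq> 0" by (metis leading_coeff_0_iff)
    then have "j \<le> degree (homog f)" "coeff (coeff f j) (degree (homog f) - j) \<noteq> 0"
      by (auto simp: coeff_homog split: if_splits)
    then show ?thesis by force
  qed (simp add: homog_hom)
  then show ?thesis unfolding total_degree_def
    using sub by (intro Max_eqI) (auto intro: finite_subset)
qed

lemma coeff_eq_0_total_degree: "total_degree f < i + j \<Longrightarrow> coeff (coeff f j) i = 0"
  using coeff_homog_neq_0[of f j i] by (force simp: total_degree_eq_degree_homog)

lemma total_degree_0 [simp]: "total_degree 0 = 0"
  and total_degree_cst [simp]: "total_degree (cst a) = 0"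
  and total_degree_minus [simp]: "total_degree (- f) = total_degree f"
  and total_degree_mult: "f \<noteq> 0 \<Longrightarrow> g \<noteq> 0 \<Longrightarrow> total_degree (f * g) = total_degree f + total_degree g"
  and total_degree_power: "f \<noteq> 0 \<Longrightarrow> total_degree (f ^ n) = n * total_degree f"
  and total_degree_add_le: "total_degree (f + g) \<le> max (total_degree f) (total_degree g)"
  and total_degree_diff_le: "total_degree (f - g) \<le> max (total_degree f) (total_degree g)"
  and total_degree_add_eq: "total_degree g < total_degree f \<Longrightarrow> total_degree (f + g) = total_degree f"
  by (simp_all add: total_degree_eq_degree_homog homog_hom degree_mult_eq degree_power_eq
      degree_add_le_max degree_diff_le_max degree_add_eq_left)
    (simp add: cst_def)

lemma total_degree_mult_le: "total_degree (f * g) \<le> total_degree f + total_degree g"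
  by (simp add: total_degree_eq_degree_homog homog_hom degree_mult_le)

lemma total_degree_cst_mult [simp]: "c \<noteq> 0 \<Longrightarrow> total_degree (cst c * f) = total_degree f"
  using total_degree_mult[of "cst c" f] by (cases "f = 0") (simp_all, simp add: cst_def)

lemma total_degree_cst_mult_le: "total_degree (cst c * f) \<le> total_degree f"
  using total_degree_mult_le[of "cst c" f] by simp

lemma total_degree_eq_0D:
  assumes "total_degree f = 0"
  shows "\<exists>a. f = cst a"
proof -
  have "coeff (coeff f j) i = coeff (coeff (cst (coeff (coeff f 0) 0)) j) i" for i j
    using coeff_eq_0_total_degree[of f i j] assms by (cases i; cases j) (auto simp: cst_def)
  then show ?thesis by (metis poly_eq_iff)
qed

text \<open>Leading forms of equal degree cannot cancel: at a real point a sum of two squares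
  vanishes only if both squares do. If the degrees differ, the larger one wins.\<close>

lemma total_degree_sum_squares:
  assumes "f \<noteq> 0" "g \<noteq> 0"
  shows "total_degree (f ^ 2 + g ^ 2) = 2 * max (total_degree f) (total_degree g)"
proof (rule linorder_cases[of "total_degree f" "total_degree g"])
  assume eq: "total_degree f = total_degree g"
  let ?F = "homog f" and ?G = "homog g"
  let ?n = "degree ?F"
  have n: "degree ?G = ?n" using eq by (simp add: total_degree_eq_degree_homog)
  have nz: "coeff ?F ?n \<noteq> 0" using assms by simp
  have "coeff (?F ^ 2 + ?G ^ 2) (2 * ?n) = coeff ?F ?n ^ 2 + coeff ?G ?n ^ 2"
    using coeff_mult_degree_sum[of ?F ?F] coeff_mult_degree_sum[of ?G ?G]
    by (simp add: power2_eq_square n mult_2)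
  also have "\<dots> \<noteq> 0"
  proof
    assume z: "coeff ?F ?n ^ 2 + coeff ?G ?n ^ 2 = 0"
    have "poly (coeff ?F ?n) t = 0" for t
      using arg_cong[OF z, of "\<lambda>p. poly p t"] by (simp add: sum_power2_eq_zero_iff)
    then show False using nz poly_all_0_iff_0 by blast
  qed
  finally have "2 * ?n \<le> degree (?F ^ 2 + ?G ^ 2)" by (rule le_degree)
  moreover have "degree (?F ^ 2 + ?G ^ 2) \<le> 2 * ?n"
    using assms n by (intro degree_add_le) (simp_all add: degree_power_eq)
  ultimately show ?thesis using n by (simp add: total_degree_eq_degree_homog homog_hom)
qed (use assms total_degree_add_eq[of "g ^ 2" "f ^ 2"] total_degree_add_eq[of "f ^ 2" "g ^ 2"] in
    \<open>auto simp: total_degree_power add.commute\<close>)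

section \<open>Affine and cubic polynomials by their coefficients\<close>

lemma affine_altdef: "affine a b p = [:[:p, a:], [:b:]:]"
  by (rule bipoly_eqI) (simp add: ev_def affine_def cst_def vx_def vy_def algebra_simps)

lemma total_degree_le_1D:
  assumes "total_degree f \<le> 1"
  obtains a b p where "f = affine a b p"
proof -
  have "f = affine (coeff (coeff f 0) 1) (coeff (coeff f 1) 0) (coeff (coeff f 0) 0)"
    unfolding affine_altdef
  proof (intro poly_eqI)
    fix i j
    show "coeff (coeff f j) i = coeff (coeff [:[:coeff (coeff f 0) 0, coeff (coeff f 0) 1:], [:coeff (coeff f 1) 0:]:] j) i"
      using coeff_eq_0_total_degree[of f i j] assms
      by (auto simp: coeff_pCons split: nat.split)
  qed
  then show ?thesis using that by blast
qed

text \<open>Lower-case letters belong to the cubic form and \<open>A\<close>, \<open>B\<close>,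
  \<open>C\<close> to the quadratic one; \<open>H\<close>, \<open>I\<close>, \<open>J\<close> keep
  the meaning they have in the list.\<close>

definition cub :: "real \<Rightarrow> real \<Rightarrow> real \<Rightarrow> real \<Rightarrow> real \<Rightarrow> real \<Rightarrow> real \<Rightarrow> real \<Rightarrow> real \<Rightarrow> real \<Rightarrow> bipoly" where
  "cub a b c d A B C H I J = [:[:J, H, A, a:], [:I, B, b:], [:C, c:], [:d:]:]"

lemma cub_inject: "cub a b c d A B C H I J = cub a' b' c' d' A' B' C' H' I' J' \<longleftrightarrow>
    a = a' \<and> b = b' \<and> c = c' \<and> d = d' \<and> A = A' \<and> B = B' \<and> C = C' \<and> H = H' \<and> I = I' \<and> J = J'"
  by (auto simp: cub_def)

lemma ev_cub [simp]: "ev (cub a b c d A B C H I J) x y =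
    a * x ^ 3 + b * x ^ 2 * y + c * x * y ^ 2 + d * y ^ 3 +
    A * x ^ 2 + B * x * y + C * y ^ 2 + H * x + I * y + J"
  by (simp add: ev_def cub_def algebra_simps power2_eq_square power3_eq_cube)

lemma total_degree_le_3D:
  assumes "total_degree f \<le> 3"
  shows "\<exists>a b c d A B C H I J. f = cub a b c d A B C H I J"
proof -
  let ?c = "\<lambda>i j. coeff (coeff f j) i"
  have "f = cub (?c 3 0) (?c 2 1) (?c 1 2) (?c 0 3) (?c 2 0) (?c 1 1) (?c 0 2) (?c 1 0) (?c 0 1) (?c 0 0)"
    unfolding cub_def
  proof (intro poly_eqI)
    fix i j
    show "?c i j = coeff (coeff [:[:?c 0 0, ?c 1 0, ?c 2 0, ?c 3 0:], [:?c 0 1, ?c 1 1, ?c 2 1:], [:?c 0 2, ?c 1 2:], [:?c 0 3:]:] j) i"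
      using coeff_eq_0_total_degree[of f i j] assms
      by (auto simp: coeff_pCons numeral_3_eq_3 numeral_2_eq_2 split: nat.split)
  qed
  then show ?thesis by blast
qed

lemma total_degree_cub_no_leading:
  "total_degree (cub 0 0 0 0 A B C H I J) \<le> 2"
proof -
  have "homog (cub 0 0 0 0 A B C H I J) = [:[:J:], [:H, I:], [:A, B, C:]:]"
    by (rule bipoly_eqI) (simp add: homog_def, simp add: ev_def algebra_simps power2_eq_square power3_eq_cube)
  then show ?thesis by (simp add: total_degree_eq_degree_homog)
qed

lemma total_degree_cub:
  assumes "a \<noteq> 0 \<or> b \<noteq> 0 \<or> c \<noteq> 0 \<or> d \<noteq> 0"
  shows "total_degree (cub a b c d A B C H I J) = 3"
proof -
  have "homog (cub a b c d A B C H I J) = [:[:J:], [:H, I:], [:A, B, C:], [:a, b, c, d:]:]"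
    by (rule bipoly_eqI) (simp add: homog_def, simp add: ev_def algebra_simps power2_eq_square power3_eq_cube)
  then show ?thesis using assms by (simp add: total_degree_eq_degree_homog)
qed

section \<open>The Jacobian bracket\<close>

lemma total_degree_leI:
  assumes "\<And>i j. n < i + j \<Longrightarrow> coeff (coeff f j) i = 0"
  shows "total_degree f \<le> n"
  unfolding total_degree_eq_degree_homog
proof (rule degree_le, intro allI impI poly_eqI)
  fix k j assume "n < k"
  then show "coeff (coeff (homog f) k) j = coeff 0 j"
    using assms[of "k - j" j] by (simp add: coeff_homog)
qed

definition dx :: "bipoly \<Rightarrow> bipoly" where
  "dx = map_poly pderiv"

definition dy :: "bipoly \<Rightarrow> bipoly" where
  "dy = pderiv"

text \<open>The Jacobian determinant, a derivation in each argument. For F = f(P, Q) the chain rule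
  becomes {F, Q} = f_x(P, Q) {P, Q}.\<close>

definition bracket :: "bipoly \<Rightarrow> bipoly \<Rightarrow> bipoly" where
  "bracket f g = dx f * dy g - dy f * dx g"

lemma coeff_dx: "coeff (coeff (dx f) j) i = of_nat (Suc i) * coeff (coeff f j) (Suc i)"
  by (simp add: dx_def coeff_map_poly coeff_pderiv)

lemma coeff_dy: "coeff (coeff (dy f) j) i = of_nat (Suc j) * coeff (coeff f (Suc j)) i"
  by (simp add: dy_def coeff_pderiv of_nat_poly)

lemma dx_mult: "dx (f * g) = f * dx g + dx f * g"
proof (rule poly_eqI)
  fix n
  \<comment> \<open>\<open>higher_pderiv_sum\<close> at order 1 is the additivity of
    \<open>pderiv\<close> over the finite sum that defines the coefficient of a product.\<close>
  show "coeff (dx (f * g)) n = coeff (f * dx g + dx f * g) n"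
    using higher_pderiv_sum[of 1 "\<lambda>i. coeff f i * coeff g (n - i)" "{..n}"]
    by (simp add: dx_def coeff_map_poly coeff_mult pderiv_mult sum.distrib) (simp add: mult.commute)
qed

lemma dx_simps: "dx (f + g) = dx f + dx g" "dx (cst a) = 0" "dx vx = 1" "dx vy = 0"
  by (rule poly_eqI, simp add: dx_def coeff_map_poly pderiv_add)
    (simp_all add: dx_def cst_def vx_def vy_def map_poly_pCons pderiv_pCons one_pCons)

lemma dy_simps: "dy (f + g) = dy f + dy g" "dy (cst a) = 0" "dy vx = 0" "dy vy = 1"
  "dy (f * g) = f * dy g + g * dy f"
  by (simp_all add: dy_def cst_def vx_def vy_def pderiv_pCons one_pCons pderiv_add pderiv_mult)

lemma bracket_simps: "bracket (f + g) h = bracket f h + bracket g h"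
  "bracket (f * g) h = f * bracket g h + g * bracket f h"
  "bracket (cst a) h = 0" "bracket f f = 0" "bracket vx h = dy h" "bracket vy h = - dx h"
  by (simp_all add: bracket_def dx_simps dy_simps dx_mult algebra_simps)

lemma bracket_antisym: "bracket g f = - bracket f g"
  by (simp add: bracket_def algebra_simps)

text \<open>Each partial derivative lowers a degree bound by one. The bounds are written with
  \<open>Suc\<close> to avoid truncated subtraction.\<close>

lemma total_degree_bracket:
  assumes "total_degree f \<le> Suc n" "total_degree g \<le> Suc m"
  shows "total_degree (bracket f g) \<le> n + m"
proof -
  have d: "total_degree (dx h) \<le> k" "total_degree (dy h) \<le> k" if "total_degree h \<le> Suc k" for h k
    by (rule total_degree_leI; use that coeff_eq_0_total_degree in \<open>force simp: coeff_dx coeff_dy\<close>)+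
  have "total_degree (dx f * dy g) \<le> n + m" "total_degree (dy f * dx g) \<le> n + m"
    using d(1,2)[OF assms(1)] d(1,2)[OF assms(2)] total_degree_mult_le order_trans add_mono by metis+
  then show ?thesis unfolding bracket_def using total_degree_diff_le order_trans max.bounded_iff by metis
qed

lemma cst_neq_vx: "cst a \<noteq> vx"
  by (simp add: cst_def vx_def)

text \<open>If the bracket vanished, then P = \<open>\<phi> vx\<close> would have zero bracket with
  every image under \<open>\<phi>\<close>, hence with \<open>vx\<close> and \<open>vy\<close>. Both
  partial derivatives of P would vanish and P would be constant, against injectivity.\<close>

lemma aut_bracket_neq_0:
  assumes \<phi>: "\<phi> \<in> ring_automorphisms"
  shows "bracket (\<phi> vx) (\<phi> vy) \<noteq> 0"
proof
  let ?P = "\<phi> vx"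
  assume z: "bracket ?P (\<phi> vy) = 0"
  have "bracket (\<phi> h) ?P = 0" for h
    by (induction h rule: bipoly_induct)
      (use z bracket_antisym[of "\<phi> vy" ?P] in \<open>simp_all add: aut_cst[OF \<phi>] aut_add[OF \<phi>] aut_mult[OF \<phi>] bracket_simps\<close>)
  then have all: "bracket h ?P = 0" for h using aut_surj[OF \<phi>] by metis
  have "dy ?P = 0" "dx ?P = 0" using all[of vx] all[of vy] by (simp_all add: bracket_simps)
  then have "coeff (coeff ?P j) (Suc i) = 0" "coeff (coeff ?P (Suc j)) i = 0" for i j
    using coeff_dx[of ?P j i] coeff_dy[of ?P j i] by simp_all
  then have "coeff (coeff ?P j) i = 0" if "0 < i + j" for i j using that by (cases i; cases j) auto
  then have "total_degree ?P \<le> 0" by (intro total_degree_leI) auto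
  then obtain a where "?P = \<phi> (cst a)" using total_degree_eq_0D aut_cst[OF \<phi>] by (metis le_zero_eq)
  then show False using aut_inj[OF \<phi>] cst_neq_vx by metis
qed

lemma aut_total_degree_pos:
  assumes "\<phi> \<in> ring_automorphisms" "\<And>a. h \<noteq> cst a"
  shows "1 \<le> total_degree (\<phi> h)"
proof (rule ccontr)
  assume "\<not> 1 \<le> total_degree (\<phi> h)"
  then obtain a where "\<phi> h = \<phi> (cst a)"
    using total_degree_eq_0D[of "\<phi> h"] aut_cst[OF assms(1)] by auto
  then show False using aut_inj[OF assms(1)] assms(2) by metis
qed

section \<open>The degree bound for Weierstrass cubics\<close>

lemma total_degree_add_dominated:
  assumes "total_degree g < total_degree f" "total_degree h < total_degree f"
  shows "total_degree (f + (g + h)) = total_degree f"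
  using assms total_degree_add_le[of g h] by (intro total_degree_add_eq) linarith

lemma affine_eq_cst_iff: "cst a * vx + cst b * vy + cst p = cst t \<longleftrightarrow> a = 0 \<and> b = 0 \<and> p = t"
  unfolding affine_def[symmetric] affine_altdef by (auto simp: cst_def)

lemma weierstrass_aut_affine:
  assumes \<phi>: "\<phi> \<in> ring_automorphisms"
    and eq: "\<phi> (cub 1 0 0 0 0 0 (-1) H 0 J) = cst c * cub 1 0 0 0 A' B' C' H' I' J'" and c: "c \<noteq> 0"
  shows "total_degree (\<phi> vx) \<le> 1 \<and> total_degree (\<phi> vy) \<le> 1"
proof -
  define P Q where "P = \<phi> vx" "Q = \<phi> vy"
  define F where "F = cst c * cub 1 0 0 0 A' B' C' H' I' J'"
  define m n where "m = total_degree P" "n = total_degree Q"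
  have F: "F = P ^ 3 + (cst (- 1) * Q ^ 2 + (cst H * P + cst J))"
    unfolding F_def eq[symmetric] by (rule bipoly_eqI) (simp add: ev_aut[OF \<phi>, of "cub _ _ _ _ _ _ _ _ _ _"] P_Q_def)
  have tF: "total_degree F = 3"
    using c by (simp add: F_def total_degree_cub)
  have m: "1 \<le> m" "1 \<le> n"
    unfolding m_n_def P_Q_def
    by (rule aut_total_degree_pos[OF \<phi>]; use affine_eq_cst_iff[of 1 0 0] affine_eq_cst_iff[of 0 1 0] in \<open>simp add: cst_simps\<close>)+
  then have nz: "P \<noteq> 0" "Q \<noteq> 0" by (auto simp: m_n_def)
  have lin: "total_degree (cst H * P + cst J) \<le> m"
    using total_degree_add_le[of "cst H * P" "cst J"] total_degree_cst_mult_le[of H P] by (simp add: m_n_def)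
  have P3: "total_degree (P ^ 3) = 3 * m" and Q2: "total_degree (cst (- 1) * Q ^ 2) = 2 * n"
    using nz by (simp_all add: total_degree_power m_n_def)
  show ?thesis
  proof (cases "3 * m = 2 * n")
    case False
    \<comment> \<open>Without a tie the degree of \<open>F\<close> is the larger of 3m and 2n. It
      equals 3, which is odd, so P^3 dominates.\<close>
    have "3 * m = 3 \<and> 2 * n < 3 * m"
    proof (cases "2 * n < 3 * m")
      case True
      then have "total_degree F = 3 * m" unfolding F P3[symmetric]
        by (intro total_degree_add_dominated) (use P3 Q2 lin m in linarith)+
      then show ?thesis using tF True by simp
    next
      case False
      have "F = cst (- 1) * Q ^ 2 + (P ^ 3 + (cst H * P + cst J))" unfolding F by simp
      moreover have "total_degree (cst (- 1) * Q ^ 2 + (P ^ 3 + (cst H * P + cst J))) = 2 * n"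
        unfolding Q2[symmetric]
        by (intro total_degree_add_dominated) (use P3 Q2 lin m False \<open>3 * m \<noteq> 2 * n\<close> in linarith)+
      ultimately show ?thesis using tF by presburger
    qed
    then show ?thesis using m by (simp add: m_n_def P_Q_def)
  next
    case True
    txt \<open>\<open>{f(P, Q), Q} = (3 P\<^sup>2 + H) {P, Q}\<close> has degree at least \<open>4 k\<close> but at most \<open>3 + 3 k - 2\<close>, so \<open>k = 1\<close>
      and \<open>{P, Q}\<close> is constant. Then \<open>{f(P, Q), P} = 2 Q {P, Q}\<close> determines the leading form of \<open>Q\<close> from
      that of \<open>P\<close>, which is incompatible with the cancellation of \<open>P\<^sup>3 - Q\<^sup>2\<close> in degree 6.\<close>
    define k where "k = m div 2"
    have k: "m = 2 * k" "n = 3 * k" using True unfolding k_def by presburger+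
    then have "1 \<le> k" using m by simp
    define W where "W = bracket P Q"
    have W: "W \<noteq> 0" using aut_bracket_neq_0[OF \<phi>] by (simp add: W_def P_Q_def)
    have FQ: "bracket F Q = (cst 3 * P ^ 2 + cst H) * W"
      by (rule bipoly_eqI)
        (simp add: F bracket_simps W_def power3_eq_cube power2_eq_square algebra_simps)
    have FP: "bracket F P = cst 2 * Q * W"
      using bracket_antisym[of P Q]
      by (intro bipoly_eqI)
        (simp add: F bracket_simps W_def power3_eq_cube power2_eq_square algebra_simps)
    have t: "total_degree (cst 3 * P ^ 2 + cst H) = 4 * k"
      using total_degree_add_eq[of "cst H" "cst 3 * P ^ 2"] nz k \<open>1 \<le> k\<close>
      by (simp add: total_degree_power m_n_def)
    then have "cst 3 * P ^ 2 + cst H \<noteq> 0" using \<open>1 \<le> k\<close> by auto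
    then have "total_degree (bracket F Q) = 4 * k + total_degree W"
      unfolding FQ by (simp add: total_degree_mult W t)
    moreover have "total_degree (bracket F Q) \<le> 2 + (3 * k - 1)"
      by (rule total_degree_bracket) (use tF k \<open>1 \<le> k\<close> in \<open>simp_all add: m_n_def\<close>)
    ultimately have k1: "k = 1" and "total_degree W = 0" using \<open>1 \<le> k\<close> by simp_all
    then obtain w where w: "W = cst w" "w \<noteq> 0" using total_degree_eq_0D W by (metis cst_simps(7))
    have tP: "degree (homog P) = 2" and tQ: "degree (homog Q) = 3"
      using k k1 by (simp_all add: m_n_def total_degree_eq_degree_homog)
    obtain p20 p11 p02 p10 p01 p00 where P: "P = cub 0 0 0 0 p20 p11 p02 p10 p01 p00"
    proof -
      obtain a b c d A B C H I J where P: "P = cub a b c d A B C H I J"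
        using total_degree_le_3D[of P] k k1 by (auto simp: m_n_def)
      then have "a = 0 \<and> b = 0 \<and> c = 0 \<and> d = 0"
        using total_degree_cub[of a b c d A B C H I J] k k1 by (auto simp: m_n_def)
      then show ?thesis using that P by blast
    qed
    define l where "l = c / (2 * w)"
    have "Q = cst (1 / (2 * w)) * bracket F P"
      using w by (intro bipoly_eqI) (simp add: FP)
    also have "\<dots> = cst l * bracket (cub 1 0 0 0 A' B' C' H' I' J') P"
      by (rule bipoly_eqI) (simp add: F_def l_def bracket_simps)
    \<comment> \<open>The cubic part is the bracket of x^3 with the quadratic form of P, namely 3
      x^2 (p11 x + 2 p02 y).\<close>
    also have "bracket (cub 1 0 0 0 A' B' C' H' I' J') P = cub (3 * p11) (6 * p02) 0 0
        (3 * p01 + 2 * A' * p11 - 2 * B' * p20) (4 * A' * p02 - 4 * C' * p20) (2 * B' * p02 - 2 * C' * p11)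
        (2 * A' * p01 + H' * p11 - B' * p10 - 2 * I' * p20)
        (B' * p01 + 2 * H' * p02 - 2 * C' * p10 - I' * p11) (H' * p01 - I' * p10)"
      by (simp add: bracket_def dx_def dy_def P cub_def map_poly_pCons pderiv_pCons algebra_simps)
    finally have "coeff (homog Q) 3 = [:l * (3 * p11), l * (6 * p02):]"
      by (auto intro!: poly_eqI simp: coeff_homog cst_def cub_def coeff_pCons numeral_3_eq_3 split: nat.split)
    then have lQ: "coeff (homog Q) 3 = [:l:] * [:3 * p11, 6 * p02:]" by simp
    have lP: "coeff (homog P) 2 = [:p20, p11, p02:]"
      by (rule poly_eqI) (auto simp: coeff_homog P cub_def coeff_pCons numeral_2_eq_2 split: nat.split)
    have "homog P ^ 3 = homog F + homog Q ^ 2 - homog (cst H * P + cst J)"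
      by (simp add: F homog_hom cst_simps)
    moreover have "coeff (homog F) 6 = 0" "coeff (homog (cst H * P + cst J)) 6 = 0"
      using tF lin k k1 by (auto intro!: coeff_eq_0 simp: total_degree_eq_degree_homog)
    ultimately have "coeff (homog P ^ 3) 6 = coeff (homog Q ^ 2) 6" by simp
    then have "lead_coeff (homog P ^ 3) = lead_coeff (homog Q ^ 2)"
      using tP tQ nz by (simp add: degree_power_eq)
    then have top: "[:p20, p11, p02:] ^ 3 = ([:l:] * [:3 * p11, 6 * p02:]) ^ 2"
      by (simp only: lead_coeff_power tP tQ lP lQ)
    \<comment> \<open>If \<open>p02\<close> were nonzero, the left side of \<open>top\<close> would
      have degree 6, while the right side is the square of a polynomial of degree at most 1. Once
      \<open>p02\<close> is 0 the right side is constant, so the coefficient of z^3 gives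
      \<open>p11 = 0\<close>, and then the constant term gives \<open>p20 = 0\<close>.\<close>
    have "p02 = 0"
    proof (rule ccontr)
      assume "p02 \<noteq> 0"
      then have "degree ([:p20, p11, p02:] ^ 3) = 6" by (simp add: degree_power_eq)
      moreover have "degree (([:l:] * [:3 * p11, 6 * p02:]) ^ 2) \<le> 2 * 1"
        using degree_power_le[of "[:l:] * [:3 * p11, 6 * p02:]" 2] by (rule order_trans) auto
      ultimately show False using top by simp
    qed
    moreover from this have "p11 = 0" using top by (simp add: power2_eq_square power3_eq_cube)
    moreover from this have "p20 = 0" using top \<open>p02 = 0\<close> by (simp add: power2_eq_square power3_eq_cube)
    ultimately have "lead_coeff (homog P) = 0" by (simp add: tP lP)
    then show ?thesis using nz by simp
  qed
qed

section \<open>Reduction to affine equivalence\<close>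

definition affine_equiv :: "bipoly \<Rightarrow> bipoly \<Rightarrow> bool" where
  "affine_equiv f g \<longleftrightarrow> (\<exists>a b p d e q c. a * e \<noteq> b * d \<and> c \<noteq> 0 \<and>
     (\<forall>x y. ev f (a * x + b * y + p) (d * x + e * y + q) = c * ev g x y))"

lemma affine_equivI:
  assumes \<phi>: "\<phi> \<in> ring_automorphisms" and eq: "\<phi> f = cst c * g" and c: "c \<noteq> 0"
    and deg: "total_degree (\<phi> vx) \<le> 1" "total_degree (\<phi> vy) \<le> 1"
  shows "affine_equiv f g"
proof -
  obtain a b p where P: "\<phi> vx = affine a b p" using total_degree_le_1D[OF deg(1)] .
  obtain d e q where Q: "\<phi> vy = affine d e q" using total_degree_le_1D[OF deg(2)] .
  \<comment> \<open>A linear dependency between the linear parts of P and Q would make the image of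
    s x + t y a constant, which by injectivity only constants have.\<close>
  have indep: "s = 0 \<and> t = 0" if "s * a + t * d = 0" "s * b + t * e = 0" for s t
  proof -
    have "\<phi> (cst s * vx + cst t * vy) = cst (s * p + t * q)"
    proof (rule bipoly_eqI)
      fix x y
      have "s * (a * x + b * y + p) + t * (d * x + e * y + q) =
          (s * a + t * d) * x + (s * b + t * e) * y + (s * p + t * q)"
        by (simp add: algebra_simps)
      then show "ev (\<phi> (cst s * vx + cst t * vy)) x y = ev (cst (s * p + t * q)) x y"
        by (simp add: ev_aut[OF \<phi>, of "cst s * vx + cst t * vy"] P Q that)
    qed
    then have "cst s * vx + cst t * vy + cst 0 = cst (s * p + t * q)"
      using aut_inj[OF \<phi>] aut_cst[OF \<phi>] by (metis add.right_neutral cst_simps(7))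
    then show ?thesis using affine_eq_cst_iff by blast
  qed
  have "a * e \<noteq> b * d"
  proof
    assume "a * e = b * d"
    \<comment> \<open>The adjugate rows (d, -a) and (e, -b) are dependencies as soon as the
      determinant vanishes.\<close>
    then have "d = 0 \<and> - a = 0" "e = 0 \<and> - b = 0"
      by (intro indep; simp add: mult.commute)+
    then show False using indep[of 1 0] by simp
  qed
  moreover have "ev f (a * x + b * y + p) (d * x + e * y + q) = c * ev g x y" for x y
    using ev_aut[OF \<phi>, of f x y] by (simp add: eq P Q)
  ultimately show ?thesis using c unfolding affine_equiv_def by blast
qed

section \<open>Cubics under affine substitutions\<close>

lemma cub_proportionalD:
  assumes "\<And>x y. ev (cub a b d e A B C H I J) x y = c * ev (cub a' b' d' e' A' B' C' H' I' J') x y"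
  shows "a = c * a' \<and> b = c * b' \<and> d = c * d' \<and> e = c * e' \<and> A = c * A' \<and> B = c * B' \<and>
    C = c * C' \<and> H = c * H' \<and> I = c * I' \<and> J = c * J'"
proof -
  have "cub a b d e A B C H I J =
      cub (c * a') (c * b') (c * d') (c * e') (c * A') (c * B') (c * C') (c * H') (c * I') (c * J')"
    by (rule bipoly_eqI) (simp only: assms, simp add: algebra_simps)
  then show ?thesis by (simp only: cub_inject)
qed

lemma ev_cub_affine:
  "ev (cub \<alpha> \<beta> \<gamma> 0 A B C H I J) (a * x + b * y + p) (d * x + e * y + q) = ev (cub
    (\<alpha> * a^3 + \<beta> * a^2 * d + \<gamma> * a * d^2)
    (3 * \<alpha> * a^2 * b + \<beta> * (2 * a * b * d + a^2 * e) + \<gamma> * (b * d^2 + 2 * a * d * e))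
    (3 * \<alpha> * a * b^2 + \<beta> * (b^2 * d + 2 * a * b * e) + \<gamma> * (a * e^2 + 2 * b * d * e))
    (\<alpha> * b^3 + \<beta> * b^2 * e + \<gamma> * b * e^2)
    (3 * \<alpha> * a^2 * p + \<beta> * (2 * a * d * p + a^2 * q) + \<gamma> * (2 * a * d * q + d^2 * p)
      + A * a^2 + B * a * d + C * d^2)
    (6 * \<alpha> * a * b * p + \<beta> * (2 * (a * e + b * d) * p + 2 * a * b * q)
      + \<gamma> * (2 * (a * e + b * d) * q + 2 * d * e * p) + 2 * A * a * b + B * (a * e + b * d) + 2 * C * d * e)
    (3 * \<alpha> * b^2 * p + \<beta> * (2 * b * e * p + b^2 * q) + \<gamma> * (2 * b * e * q + e^2 * p)
      + A * b^2 + B * b * e + C * e^2)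
    (3 * \<alpha> * a * p^2 + \<beta> * (2 * a * p * q + d * p^2) + \<gamma> * (a * q^2 + 2 * d * p * q)
      + 2 * A * a * p + B * (a * q + d * p) + 2 * C * d * q + H * a + I * d)
    (3 * \<alpha> * b * p^2 + \<beta> * (2 * b * p * q + e * p^2) + \<gamma> * (b * q^2 + 2 * e * p * q)
      + 2 * A * b * p + B * (b * q + e * p) + 2 * C * e * q + H * b + I * e)
    (\<alpha> * p^3 + \<beta> * p^2 * q + \<gamma> * p * q^2 + A * p^2 + B * p * q + C * q^2 + H * p + I * q + J)) x y"
  by (simp only: ev_cub mult_zero_left add_0_right) algebra

text \<open>The coefficientwise form of \<open>f(a x + b y + p, d x + e y + q) = c g\<close>, for \<open>f\<close> without a \<open>y\<^sup>3\<close> term.\<close>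

definition affine_coeffs where
  "affine_coeffs a b p d e q c \<alpha> \<beta> \<gamma> A B C H I J \<alpha>' \<beta>' \<gamma>' \<delta>' A' B' C' H' I' J' \<longleftrightarrow>
     a * e \<noteq> b * d \<and>
     c \<noteq> 0 \<and>
     \<alpha> * a^3 + \<beta> * a^2 * d + \<gamma> * a * d^2 = c * \<alpha>' \<and>
     3 * \<alpha> * a^2 * b + \<beta> * (2 * a * b * d + a^2 * e) + \<gamma> * (b * d^2 + 2 * a * d * e) = c * \<beta>' \<and>
     3 * \<alpha> * a * b^2 + \<beta> * (b^2 * d + 2 * a * b * e) + \<gamma> * (a * e^2 + 2 * b * d * e) = c * \<gamma>' \<and>
     \<alpha> * b^3 + \<beta> * b^2 * e + \<gamma> * b * e^2 = c * \<delta>' \<and>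
     3 * \<alpha> * a^2 * p + \<beta> * (2 * a * d * p + a^2 * q) + \<gamma> * (2 * a * d * q + d^2 * p)
      + A * a^2 + B * a * d + C * d^2 = c * A' \<and>
     6 * \<alpha> * a * b * p + \<beta> * (2 * (a * e + b * d) * p + 2 * a * b * q)
      + \<gamma> * (2 * (a * e + b * d) * q + 2 * d * e * p) + 2 * A * a * b + B * (a * e + b * d) + 2 * C * d * e = c * B' \<and>
     3 * \<alpha> * b^2 * p + \<beta> * (2 * b * e * p + b^2 * q) + \<gamma> * (2 * b * e * q + e^2 * p)
      + A * b^2 + B * b * e + C * e^2 = c * C' \<and>
     3 * \<alpha> * a * p^2 + \<beta> * (2 * a * p * q + d * p^2) + \<gamma> * (a * q^2 + 2 * d * p * q)
      + 2 * A * a * p + B * (a * q + d * p) + 2 * C * d * q + H * a + I * d = c * H' \<and>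
     3 * \<alpha> * b * p^2 + \<beta> * (2 * b * p * q + e * p^2) + \<gamma> * (b * q^2 + 2 * e * p * q)
      + 2 * A * b * p + B * (b * q + e * p) + 2 * C * e * q + H * b + I * e = c * I' \<and>
     \<alpha> * p^3 + \<beta> * p^2 * q + \<gamma> * p * q^2 + A * p^2 + B * p * q + C * q^2 + H * p + I * q + J = c * J'" for a b :: real

lemma affine_equivE:
  assumes "affine_equiv (cub \<alpha> \<beta> \<gamma> 0 A B C H I J) (cub \<alpha>' \<beta>' \<gamma>' \<delta>' A' B' C' H' I' J')"
  obtains a b p d e q c where
    "affine_coeffs a b p d e q c \<alpha> \<beta> \<gamma> A B C H I J \<alpha>' \<beta>' \<gamma>' \<delta>' A' B' C' H' I' J'"
proof -
  obtain a b p d e q c where det: "a * e \<noteq> b * d" "c \<noteq> 0" and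
    eq: "\<And>x y. ev (cub \<alpha> \<beta> \<gamma> 0 A B C H I J) (a * x + b * y + p) (d * x + e * y + q) =
      c * ev (cub \<alpha>' \<beta>' \<gamma>' \<delta>' A' B' C' H' I' J') x y"
    using assms unfolding affine_equiv_def by blast
  have "affine_coeffs a b p d e q c \<alpha> \<beta> \<gamma> A B C H I J \<alpha>' \<beta>' \<gamma>' \<delta>' A' B' C' H' I' J'"
    unfolding affine_coeffs_def
    by (intro conjI[OF det(1)] conjI[OF det(2)], rule cub_proportionalD)
      (simp only: eq[symmetric] ev_cub_affine)
  then show thesis by (rule that)
qed

section \<open>Degree counts for the canonical cubic forms\<close>

lemma total_degree_add_bound:
  "total_degree f \<le> k \<Longrightarrow> total_degree g \<le> k \<Longrightarrow> total_degree (f + g) \<le> k"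
  using total_degree_add_le[of f g] by linarith

lemma total_degree_cst_mult_bound: "total_degree f \<le> k \<Longrightarrow> total_degree (cst c * f) \<le> k"
  using total_degree_cst_mult_le[of c f] by linarith

lemmas total_degree_bounds = total_degree_add_bound total_degree_cst_mult_bound

lemma aut_vars_total_degree_pos:
  assumes "\<phi> \<in> ring_automorphisms"
  shows "1 \<le> total_degree (\<phi> vx)" "1 \<le> total_degree (\<phi> vy)"
  by (rule aut_total_degree_pos[OF assms]; use affine_eq_cst_iff[of 1 0 0] affine_eq_cst_iff[of 0 1 0] in \<open>simp add: cst_simps\<close>)+

lemma aut_equivE:
  assumes "aut_equiv f g" "total_degree g = 3"
  obtains \<phi> c where "\<phi> \<in> ring_automorphisms" "c \<noteq> 0" "\<phi> f = cst c * g" "total_degree (\<phi> f) = 3"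
proof -
  obtain \<phi> c where *: "\<phi> \<in> ring_automorphisms" "c \<noteq> 0" "\<phi> f = cst c * g"
    using assms(1) unfolding aut_equiv_def by blast
  then have "total_degree (\<phi> f) = 3" using assms(2) by simp
  then show thesis using that * by blast
qed

lemma aut_cub: 
  assumes "\<phi> \<in> ring_automorphisms"
  shows "\<phi> (cub a b c d A B C H I J) = cst a * \<phi> vx ^ 3 + cst b * (\<phi> vx ^ 2 * \<phi> vy) +
    cst c * (\<phi> vx * \<phi> vy ^ 2) + cst d * \<phi> vy ^ 3 +
    cst A * \<phi> vx ^ 2 + cst B * (\<phi> vx * \<phi> vy) + cst C * \<phi> vy ^ 2 + cst H * \<phi> vx + cst I * \<phi> vy + cst J"
  by (rule bipoly_eqI) (simp add: ev_aut[OF assms, of "cub _ _ _ _ _ _ _ _ _ _"])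

text \<open>With m the larger of deg P and deg Q, P (P^2 + Q^2) has degree exactly deg P + 2m,
  because a sum of real squares keeps its degree. All other terms have degree at most 2m.\<close>

lemma aut_equiv_L1_affine:
  assumes "aut_equiv (cub 1 0 1 0 A 0 0 H I J) g" "total_degree g = 3"
  shows "affine_equiv (cub 1 0 1 0 A 0 0 H I J) g"
proof -
  obtain \<phi> c where \<phi>: "\<phi> \<in> ring_automorphisms" and c: "c \<noteq> 0"
    and eq: "\<phi> (cub 1 0 1 0 A 0 0 H I J) = cst c * g" and t3: "total_degree (\<phi> (cub 1 0 1 0 A 0 0 H I J)) = 3"
    using aut_equivE[OF assms] .
  define P Q where "P = \<phi> vx" "Q = \<phi> vy"
  define m where "m = max (total_degree P) (total_degree Q)"
  have pos: "1 \<le> total_degree P" "1 \<le> total_degree Q"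
    using aut_vars_total_degree_pos[OF \<phi>] by (simp_all add: P_Q_def)
  then have nz: "P \<noteq> 0" "Q \<noteq> 0" by auto
  have sq: "total_degree (P ^ 2 + Q ^ 2) = 2 * m" using nz by (simp add: total_degree_sum_squares m_def)
  then have "P ^ 2 + Q ^ 2 \<noteq> 0" using pos by (auto simp: m_def)
  then have top: "total_degree (P * (P ^ 2 + Q ^ 2)) = total_degree P + 2 * m"
    using nz sq by (simp add: total_degree_mult)
  define R where "R = cst A * P ^ 2 + cst H * P + cst I * Q + cst J"
  have "total_degree R \<le> 2 * m"
    unfolding R_def using nz by (intro total_degree_bounds) (auto simp: total_degree_power m_def)
  then have "total_degree (P * (P ^ 2 + Q ^ 2) + R) = total_degree P + 2 * m"
    unfolding top[symmetric] using top pos by (intro total_degree_add_eq) linarith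
  moreover have "\<phi> (cub 1 0 1 0 A 0 0 H I J) = P * (P ^ 2 + Q ^ 2) + R"
    by (simp add: aut_cub[OF \<phi>] P_Q_def R_def cst_simps algebra_simps power2_eq_square power3_eq_cube)
  ultimately have "m \<le> 1" using t3 pos by simp
  then show ?thesis using affine_equivI[OF \<phi> eq c] by (simp add: m_def P_Q_def)
qed

text \<open>Q is a combination of any two of P, S = P + Q, T = P - Q, so at least two of these have
  degree at least q. Hence p + s + t exceeds 2q, the product P S T dominates, and p + s + t = 3
  leaves only degree 1 for each factor.\<close>

lemma aut_equiv_L2_affine:
  assumes "aut_equiv (cub 1 0 (-1) 0 0 0 C H I J) g" "total_degree g = 3"
  shows "affine_equiv (cub 1 0 (-1) 0 0 0 C H I J) g"
proof -
  let ?f = "cub 1 0 (-1) 0 0 0 C H I J"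
  obtain \<phi> c where \<phi>: "\<phi> \<in> ring_automorphisms" and c: "c \<noteq> 0"
    and eq: "\<phi> ?f = cst c * g" and t3: "total_degree (\<phi> ?f) = 3"
    using aut_equivE[OF assms] .
  define P Q where "P = \<phi> vx" "Q = \<phi> vy"
  define S T where "S = P + Q" "T = P + cst (- 1) * Q"
  define p q s t where "p = total_degree P" "q = total_degree Q" "s = total_degree S" "t = total_degree T"
  have ST: "S = \<phi> (vx + vy)" "T = \<phi> (vx + cst (- 1) * vy)"
    by (simp_all add: S_T_def P_Q_def aut_add[OF \<phi>] aut_mult[OF \<phi>] aut_cst[OF \<phi>])
  have nc: "vx + vy \<noteq> cst a" "vx + cst (- 1) * vy \<noteq> cst a" for a
    using affine_eq_cst_iff[of 1 1 0 a] affine_eq_cst_iff[of 1 "- 1" 0 a] by (simp_all add: cst_simps)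
  have st: "1 \<le> s" "1 \<le> t"
    using aut_total_degree_pos[OF \<phi> nc(1)] aut_total_degree_pos[OF \<phi> nc(2)]
    by (simp_all add: p_q_s_t_def ST)
  have pos: "1 \<le> p" "1 \<le> q"
    using aut_vars_total_degree_pos[OF \<phi>] by (simp_all add: P_Q_def p_q_s_t_def)
  then have nz: "P \<noteq> 0" "Q \<noteq> 0" "S \<noteq> 0" "T \<noteq> 0" using st by (auto simp: p_q_s_t_def)
  have Q: "Q = S + cst (- 1) * P" "Q = P + cst (- 1) * T" "Q = cst (1 / 2) * (S + cst (- 1) * T)"
    by (rule bipoly_eqI; simp add: S_T_def)+
  have "total_degree (S + cst (- 1) * P) \<le> max s p" "total_degree (P + cst (- 1) * T) \<le> max p t"
    "total_degree (cst (1 / 2) * (S + cst (- 1) * T)) \<le> max s t"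
    by (intro total_degree_bounds; simp add: p_q_s_t_def)+
  then have q: "q \<le> max s p" "q \<le> max p t" "q \<le> max s t"
    by (simp_all only: Q[symmetric] p_q_s_t_def)
  have top: "total_degree (P * (S * T)) = p + (s + t)"
    using nz by (simp add: total_degree_mult p_q_s_t_def)
  define R where "R = cst C * Q ^ 2 + cst H * P + cst I * Q + cst J"
  have "total_degree R \<le> max (2 * q) p"
    unfolding R_def using nz by (intro total_degree_bounds) (auto simp: total_degree_power p_q_s_t_def)
  then have "total_degree (P * (S * T) + R) = p + (s + t)"
    unfolding top[symmetric] using top pos st q by (intro total_degree_add_eq) linarith
  moreover have "\<phi> ?f = P * (S * T) + R"
    by (simp add: aut_cub[OF \<phi>] P_Q_def[symmetric])
      (simp add: S_T_def R_def cst_simps algebra_simps power2_eq_square power3_eq_cube)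
  ultimately have "p + (s + t) = 3" using t3 by simp
  then have "p \<le> 1" "q \<le> 1" using pos st q by linarith+
  then show ?thesis using affine_equivI[OF \<phi> eq c] by (simp add: p_q_s_t_def P_Q_def)
qed

text \<open>For \<open>C = 1\<close> the terms P^2 Q and Q^2 may cancel. Writing them together with
  I Q as Q R, where R = P^2 + Q + I, makes the degree additive; P^2 = R - Q - I bounds deg P by the
  degrees of the two factors.\<close>

lemma aut_equiv_L3_affine:
  assumes "aut_equiv (cub 0 1 0 0 0 0 C H I J) g" "total_degree g = 3" and C: "C = 0 \<or> C = 1"
  shows "affine_equiv (cub 0 1 0 0 0 0 C H I J) g"
proof -
  let ?f = "cub 0 1 0 0 0 0 C H I J"
  obtain \<phi> c where \<phi>: "\<phi> \<in> ring_automorphisms" and c: "c \<noteq> 0"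
    and eq: "\<phi> ?f = cst c * g" and t3: "total_degree (\<phi> ?f) = 3"
    using aut_equivE[OF assms(1,2)] .
  define P Q where "P = \<phi> vx" "Q = \<phi> vy"
  define m n where "m = total_degree P" "n = total_degree Q"
  have pos: "1 \<le> m" "1 \<le> n"
    using aut_vars_total_degree_pos[OF \<phi>] by (simp_all add: P_Q_def m_n_def)
  then have nz: "P \<noteq> 0" "Q \<noteq> 0" by (auto simp: m_n_def)
  show ?thesis using C
  proof
    assume [simp]: "C = 0"
    have top: "total_degree (P ^ 2 * Q) = 2 * m + n"
      using nz by (simp add: total_degree_mult total_degree_power m_n_def)
    define R where "R = cst H * P + cst I * Q + cst J"
    have "total_degree R \<le> max m n"
      unfolding R_def by (intro total_degree_bounds) (auto simp: m_n_def)
    then have "total_degree (P ^ 2 * Q + R) = 2 * m + n"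
      unfolding top[symmetric] using top pos by (intro total_degree_add_eq) linarith
    moreover have "\<phi> ?f = P ^ 2 * Q + R"
      by (simp add: aut_cub[OF \<phi>] P_Q_def R_def cst_simps)
    ultimately have "2 * m + n = 3" using t3 by simp
    then have "m \<le> 1" "n \<le> 1" using pos by linarith+
    then show ?thesis using affine_equivI[OF \<phi> eq c] by (simp add: m_n_def P_Q_def)
  next
    assume [simp]: "C = 1"
    define R where "R = P ^ 2 + Q + cst I"
    define r where "r = total_degree R"
    have R: "R = \<phi> (vx ^ 2 + vy + cst I)"
      by (simp add: R_def P_Q_def aut_add[OF \<phi>] aut_mult[OF \<phi>] aut_cst[OF \<phi>] power2_eq_square)
    have "vx ^ 2 + vy + cst I \<noteq> cst a" for a
      by (simp add: vx_def vy_def cst_def power2_eq_square)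
    then have r: "1 \<le> r" unfolding r_def R by (rule aut_total_degree_pos[OF \<phi>])
    then have nzR: "R \<noteq> 0" by (auto simp: r_def)
    have "P ^ 2 = R + cst (- 1) * Q + cst (- I)"
      by (simp add: R_def cst_simps)
    then have "total_degree (P ^ 2) \<le> max r n"
      unfolding r_def m_n_def by (metis total_degree_bounds max.cobounded1 max.cobounded2 total_degree_cst zero_le)
    then have mrn: "2 * m \<le> max r n" using nz by (simp add: total_degree_power m_n_def)
    have top: "total_degree (Q * R) = n + r" using nz nzR by (simp add: total_degree_mult m_n_def r_def)
    have "total_degree (cst H * P + cst J) \<le> m"
      by (intro total_degree_bounds) (auto simp: m_n_def)
    then have "total_degree (Q * R + (cst H * P + cst J)) = n + r"
      unfolding top[symmetric] using top pos r mrn by (intro total_degree_add_eq) linarith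
    moreover have "\<phi> ?f = Q * R + (cst H * P + cst J)"
      by (simp add: aut_cub[OF \<phi>] P_Q_def R_def cst_simps algebra_simps power2_eq_square)
    ultimately have nr: "n + r = 3" using t3 by simp
    then have m1: "m \<le> 1" using mrn r pos by linarith
    show ?thesis
    proof (cases "n \<le> 1")
      case True
      then show ?thesis using affine_equivI[OF \<phi> eq c] m1 by (simp add: m_n_def P_Q_def)
    next
      case False
      then have r1: "r = 1" using nr r by linarith
      txt \<open>\<open>\<psi>\<close> fixes \<open>f\<close> because \<open>f = y (x\<^sup>2 + y + I) + H x + J\<close>; it exchanges \<open>Q\<close> with \<open>- R\<close>.\<close>
      define \<psi> where "\<psi> = subst vx (- (vx ^ 2 + vy + cst I))"
      have \<psi>: "\<psi> \<in> ring_automorphisms"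
        unfolding \<psi>_def
        by (rule subst_ring_automorphism[of _ vx "- (vx ^ 2 + vy + cst I)"]) simp_all
      have \<psi>_eqs: "\<psi> ?f = ?f" "\<psi> vx = vx" "\<psi> vy = - (vx ^ 2 + vy + cst I)"
        unfolding \<psi>_def by (rule bipoly_eqI; simp add: algebra_simps power2_eq_square)+
      have neg: "\<phi> (- h) = - \<phi> h" for h
        using aut_add[OF \<phi>, of h "- h"] aut_add[OF \<phi>, of 0 0] by (simp add: add_eq_0_iff)
      have "(\<phi> \<circ> \<psi>) ?f = cst c * g" "(\<phi> \<circ> \<psi>) vx = P" "(\<phi> \<circ> \<psi>) vy = - R"
        by (simp_all only: o_apply \<psi>_eqs neg eq R P_Q_def)
      then show ?thesis using affine_equivI[OF ring_automorphisms_comp[OF \<phi> \<psi>] _ c] m1 r1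
        by (simp add: m_n_def r_def)
    qed
  qed
qed

lemma aut_equiv_weierstrass_affine:
  assumes "aut_equiv (cub 1 0 0 0 0 0 (-1) H 0 J) (cub 1 0 0 0 A' B' C' H' I' J')"
  shows "affine_equiv (cub 1 0 0 0 0 0 (-1) H 0 J) (cub 1 0 0 0 A' B' C' H' I' J')"
proof -
  obtain \<phi> c where \<phi>: "\<phi> \<in> ring_automorphisms" and c: "c \<noteq> 0"
    and eq: "\<phi> (cub 1 0 0 0 0 0 (-1) H 0 J) = cst c * cub 1 0 0 0 A' B' C' H' I' J'"
    using assms unfolding aut_equiv_def by blast
  show ?thesis
    using weierstrass_aut_affine[OF \<phi> eq c] affine_equivI[OF \<phi> eq c] by blast
qed

section \<open>Uniqueness of the normal forms\<close>

definition normal1 :: "real \<Rightarrow> real \<Rightarrow> real \<Rightarrow> real \<Rightarrow> bool" where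
  "normal1 A H I J \<longleftrightarrow> A = 1 \<and> 0 \<le> I \<or> A = 0 \<and> I = 1 \<and> 0 \<le> J \<or>
     A = 0 \<and> I = 0 \<and> (H = 1 \<or> H = -1) \<and> 0 \<le> J \<or> A = 0 \<and> I = 0 \<and> H = 0 \<and> (J = 1 \<or> J = 0)"

text \<open>
  The symmetries of \<open>x(x - y)(x + y)\<close> permute its three lines and act on \<open>(H, I)\<close> as a dihedral group of
  order 6, centred at \<open>(-3/4, 0)\<close> if \<open>C = -1\<close> and at \<open>0\<close> if \<open>C = 0\<close>. The inequalities cut out a chamber.
\<close>

definition normal2 :: "real \<Rightarrow> real \<Rightarrow> real \<Rightarrow> real \<Rightarrow> bool" where
  "normal2 C H I J \<longleftrightarrow> C = -1 \<and> 0 \<le> I \<and> H + I \<le> -3/4 \<or> C = 0 \<and> I = -1 \<and> 0 \<le> J \<and> -1 \<le> H \<and> H \<le> 1 \<or>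
     C = 0 \<and> H = 0 \<and> I = 0 \<and> (J = 1 \<or> J = 0)"

definition normal3 :: "real \<Rightarrow> real \<Rightarrow> real \<Rightarrow> real \<Rightarrow> bool" where
  "normal3 C H I J \<longleftrightarrow>
     C = 1 \<and> (H = -1 \<or> H = 0 \<and> (I = 1 \<or> I = -1) \<or> H = 0 \<and> I = 0 \<and> (J = 1 \<or> J = -1 \<or> J = 0)) \<or>
     C = 0 \<and> (H = -1 \<and> (I = 1 \<or> I = -1) \<and> 0 \<le> J \<or> H = 0 \<and> (I = 1 \<or> I = -1) \<and> (J = 1 \<or> J = 0) \<or>
       H = -1 \<and> I = 0 \<and> (J = 1 \<or> J = 0) \<or> H = 0 \<and> I = 0 \<and> (J = -1 \<or> J = 0))"

definition weierstrass :: "real \<Rightarrow> real \<Rightarrow> real \<Rightarrow> real \<Rightarrow> real \<Rightarrow> bool" where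
  "weierstrass B C H I J \<longleftrightarrow> B = 0 \<and> C = -1 \<and> I = 0 \<and>
     (H = 1 \<or> H = -1 \<or> H = 0 \<and> (J = 1 \<or> J = -1 \<or> J = 0))"

definition univariate :: "real \<Rightarrow> real \<Rightarrow> real \<Rightarrow> real \<Rightarrow> real \<Rightarrow> bool" where
  "univariate B C H I J \<longleftrightarrow> B = 0 \<and> C = 0 \<and> I = 0 \<and> ((H = 1 \<or> H = -1) \<and> 0 \<le> J \<or> H = 0 \<and> (J = 1 \<or> J = 0))"

text \<open>These are -y and -xy + J after y is replaced by y + x^3 or y + x^2. Their equivalences
  need not be affine, so they are kept apart from the other cubics with leading form x^3.\<close>

definition y_linear :: "real \<Rightarrow> real \<Rightarrow> real \<Rightarrow> real \<Rightarrow> real \<Rightarrow> bool" where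
  "y_linear B C H I J \<longleftrightarrow> C = 0 \<and> H = 0 \<and> (B = 0 \<and> I = -1 \<and> J = 0 \<or> B = -1 \<and> I = 0 \<and> (J = 1 \<or> J = 0))"

definition normal4 :: "real \<Rightarrow> real \<Rightarrow> real \<Rightarrow> real \<Rightarrow> real \<Rightarrow> bool" where
  "normal4 B C H I J \<longleftrightarrow> weierstrass B C H I J \<or> univariate B C H I J \<or> y_linear B C H I J"

section \<open>The four lists in terms of coefficients\<close>

lemma list_L1_iff: "f \<in> list_L1 \<longleftrightarrow> (\<exists>A H I J. f = cub 1 0 1 0 A 0 0 H I J \<and> normal1 A H I J)"
proof -
  have e6: "vx^3 + vx * vy^2 + vx^2 + cst H * vx + cst I * vy + cst J = cub 1 0 1 0 1 0 0 H I J" for H I J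
    by (rule bipoly_eqI; simp)+
  have e5: "vx^3 + vx * vy^2 + vy + cst H * vx + cst J = cub 1 0 1 0 0 0 0 H 1 J" for H J
    by (rule bipoly_eqI; simp)+
  have e4: "vx^3 + vx * vy^2 + vx + cst J = cub 1 0 1 0 0 0 0 1 0 J"
    "vx^3 + vx * vy^2 - vx + cst J = cub 1 0 1 0 0 0 0 (-1) 0 J" for J
    by (rule bipoly_eqI; simp)+
  have e3: "vx^3 + vx * vy^2 + 1 = cub 1 0 1 0 0 0 0 0 0 1"
    by (rule bipoly_eqI; simp)+
  have e2: "vx^3 + vx * vy^2 = cub 1 0 1 0 0 0 0 0 0 0"
    by (rule bipoly_eqI; simp)+
  \<comment> \<open>Longer sums are rewritten first, because the shorter ones are initial segments
    of them.\<close>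
  show ?thesis unfolding list_L1_def normal1_def
    unfolding e6 unfolding e5 unfolding e4 unfolding e3 unfolding e2 by auto
qed

lemma list_L2_iff: "f \<in> list_L2 \<longleftrightarrow> (\<exists>C H I J. f = cub 1 0 (-1) 0 0 0 C H I J \<and> normal2 C H I J)"
proof -
  have e6: "vx^3 - vx * vy^2 - vy^2 + cst H * vx + cst I * vy + cst J = cub 1 0 (-1) 0 0 0 (-1) H I J" for H I J
    by (rule bipoly_eqI; simp)+
  have e5: "vx^3 - vx * vy^2 - vy + cst H * vx + cst J = cub 1 0 (-1) 0 0 0 0 H (-1) J" for H J
    by (rule bipoly_eqI; simp)+
  have e3: "vx^3 - vx * vy^2 + 1 = cub 1 0 (-1) 0 0 0 0 0 0 1"
    by (rule bipoly_eqI; simp)+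
  have e2: "vx^3 - vx * vy^2 = cub 1 0 (-1) 0 0 0 0 0 0 0"
    by (rule bipoly_eqI; simp)+
  show ?thesis unfolding list_L2_def normal2_def
    unfolding e6 unfolding e5 unfolding e3 unfolding e2 by auto
qed

lemma list_L3_iff: "f \<in> list_L3 \<longleftrightarrow> (\<exists>C H I J. f = cub 0 1 0 0 0 0 C H I J \<and> normal3 C H I J)"
proof -
  have e5: "vx^2 * vy + vy^2 - vx + cst I * vy + cst J = cub 0 1 0 0 0 0 1 (-1) I J" for I J
    by (rule bipoly_eqI; simp)+
  have e4: "vx^2 * vy + vy^2 + vy + cst J = cub 0 1 0 0 0 0 1 0 1 J"
    "vx^2 * vy + vy^2 - vy + cst J = cub 0 1 0 0 0 0 1 0 (-1) J"
    "vx^2 * vy - vx + vy + cst J = cub 0 1 0 0 0 0 0 (-1) 1 J"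
    "vx^2 * vy - vx - vy + cst J = cub 0 1 0 0 0 0 0 (-1) (-1) J" for J
    by (rule bipoly_eqI; simp)+
  have e3: "vx^2 * vy + vy^2 + 1 = cub 0 1 0 0 0 0 1 0 0 1"
    "vx^2 * vy + vy^2 - 1 = cub 0 1 0 0 0 0 1 0 0 (-1)"
    "vx^2 * vy + vy + 1 = cub 0 1 0 0 0 0 0 0 1 1"
    "vx^2 * vy - vy + 1 = cub 0 1 0 0 0 0 0 0 (-1) 1"
    "vx^2 * vy - vx + 1 = cub 0 1 0 0 0 0 0 (-1) 0 1"
    by (rule bipoly_eqI; simp)+
  have e2: "vx^2 * vy + vy^2 = cub 0 1 0 0 0 0 1 0 0 0"
    "vx^2 * vy + vy = cub 0 1 0 0 0 0 0 0 1 0"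
    "vx^2 * vy - vy = cub 0 1 0 0 0 0 0 0 (-1) 0"
    "vx^2 * vy - vx = cub 0 1 0 0 0 0 0 (-1) 0 0"
    "vx^2 * vy - 1 = cub 0 1 0 0 0 0 0 0 0 (-1)"
    by (rule bipoly_eqI; simp)+
  have e1: "vx^2 * vy = cub 0 1 0 0 0 0 0 0 0 0"
    by (rule bipoly_eqI; simp)+
  show ?thesis unfolding list_L3_def normal3_def
    unfolding e5 unfolding e4 unfolding e3 unfolding e2 unfolding e1 by auto
qed

lemma list_L4_iff: "f \<in> list_L4 \<longleftrightarrow> (\<exists>B C H I J. f = cub 1 0 0 0 0 B C H I J \<and> normal4 B C H I J)"
proof -
  have e4: "vx^3 - vy^2 + vx + cst J = cub 1 0 0 0 0 0 (-1) 1 0 J"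
    "vx^3 - vy^2 - vx + cst J = cub 1 0 0 0 0 0 (-1) (-1) 0 J" for J
    by (rule bipoly_eqI; simp)+
  have e3: "vx^3 - vy^2 + 1 = cub 1 0 0 0 0 0 (-1) 0 0 1"
    "vx^3 - vy^2 - 1 = cub 1 0 0 0 0 0 (-1) 0 0 (-1)"
    "vx^3 - vx * vy + 1 = cub 1 0 0 0 0 (-1) 0 0 0 1"
    "vx^3 + vx + cst J = cub 1 0 0 0 0 0 0 1 0 J"
    "vx^3 - vx + cst J = cub 1 0 0 0 0 0 0 (-1) 0 J" for J
    by (rule bipoly_eqI; simp)+
  have e2: "vx^3 - vy^2 = cub 1 0 0 0 0 0 (-1) 0 0 0"
    "vx^3 - vy = cub 1 0 0 0 0 0 0 0 (-1) 0"
    "vx^3 - vx * vy = cub 1 0 0 0 0 (-1) 0 0 0 0"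
    "vx^3 + 1 = cub 1 0 0 0 0 0 0 0 0 1"
    by (rule bipoly_eqI; simp)+
  have e1: "vx^3 = cub 1 0 0 0 0 0 0 0 0 0"
    by (rule bipoly_eqI; simp)+
  show ?thesis unfolding list_L4_def normal4_def weierstrass_def univariate_def y_linear_def
    unfolding e4 unfolding e3 unfolding e2 unfolding e1 by (auto simp: cub_inject)
qed

section \<open>Normal forms with equal leading form\<close>

lemma power2_neq_minus_one: "a ^ 2 \<noteq> (-1::real)"
  by (metis neg_0_le_iff_le not_one_le_zero zero_le_power2)

lemma scaled_reflection:
  fixes a :: real
  assumes "a \<noteq> 0" "e = a \<or> e = - a" "I * e = a ^ 3 * I'"
  shows "I = a ^ 2 * I' \<or> I = - (a ^ 2 * I')"
  using assms(2)
proof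
  assume "e = a"
  then have "a * I = a * (a ^ 2 * I')"
    using assms(3) by (simp add: power2_eq_square power3_eq_cube mult_ac)
  then show ?thesis using assms(1) by simp
next
  assume "e = - a"
  then have "a * - I = a * (a ^ 2 * I')"
    using assms(3) by (simp add: power2_eq_square power3_eq_cube mult_ac)
  then have "- I = a ^ 2 * I'" using assms(1) by (simp only: mult_cancel_left) simp
  then show ?thesis by linarith
qed

text \<open>The only real line of x (x^2 + y^2) must be preserved, which gives \<open>b = 0\<close>.
  The remaining equations reduce the map to x -> a x, y -> \<plusminus> a y with
  \<open>c = a ^ 3\<close>, so \<open>A\<close> has weight 1, \<open>H\<close> and \<open>I\<close>
  weight 2, \<open>J\<close> weight 3, and the sign of \<open>I\<close> is free.\<close>

lemma normal1_unique:
  assumes eq: "affine_equiv (cub 1 0 1 0 A 0 0 H I J) (cub 1 0 1 0 A' 0 0 H' I' J')"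
    and n: "normal1 A H I J" "normal1 A' H' I' J'"
  shows "cub 1 0 1 0 A 0 0 H I J = cub 1 0 1 0 A' 0 0 H' I' J'"
proof -
  obtain a b p d e q c where
    coeffs: "affine_coeffs a b p d e q c 1 0 1 A 0 0 H I J 1 0 1 0 A' 0 0 H' I' J'"
    by (rule affine_equivE[OF eq])
  then have E: "a * e \<noteq> b * d" "c \<noteq> 0" "a ^ 3 + a * d ^ 2 = c"
    "3 * a ^ 2 * b + (b * d ^ 2 + 2 * a * d * e) = 0"
    "3 * a * b ^ 2 + (a * e ^ 2 + 2 * b * d * e) = c" "b ^ 3 + b * e ^ 2 = 0"
    "6 * a * b * p + (2 * (a * e + b * d) * q + 2 * d * e * p) + 2 * A * a * b = 0"
    "3 * b ^ 2 * p + (2 * b * e * q + e ^ 2 * p) + A * b ^ 2 = 0"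
    "3 * a ^ 2 * p + (2 * a * d * q + d ^ 2 * p) + A * a ^ 2 = c * A'"
    "3 * a * p ^ 2 + (a * q ^ 2 + 2 * d * p * q) + 2 * A * a * p + H * a + I * d = c * H'"
    "3 * b * p ^ 2 + (b * q ^ 2 + 2 * e * p * q) + 2 * A * b * p + H * b + I * e = c * I'"
    "p ^ 3 + p * q ^ 2 + A * p ^ 2 + H * p + I * q + J = c * J'"
    unfolding affine_coeffs_def by (simp_all add: algebra_simps)
  have "b * (b ^ 2 + e ^ 2) = 0" using E(6) by (simp add: algebra_simps power2_eq_square power3_eq_cube)
  then have b: "b = 0" by (auto simp: sum_power2_eq_zero_iff)
  then have ae: "a \<noteq> 0" "e \<noteq> 0" using E(1) by auto
  then have d: "d = 0" using E(4) b by simp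
  have p: "p = 0" using E(8) b ae by simp
  have q: "q = 0" using E(7) b d ae by simp
  have c: "c = a ^ 3" using E(3) d by simp
  have "e ^ 2 = a ^ 2" using E(5) b c ae by (simp add: power2_eq_square power3_eq_cube)
  then have e: "e = a \<or> e = - a" by (simp add: power2_eq_iff)
  have A: "A = a * A'" and H: "H = a ^ 2 * H'" and J: "J = a ^ 3 * J'"
    using E(9,10,12) b d p q c ae by (simp_all add: power2_eq_square power3_eq_cube)
  have I: "I = a ^ 2 * I' \<or> I = - (a ^ 2 * I')"
    using e E(11) b p q c ae scaled_reflection[of a e I I'] by auto
  have "A = A' \<and> H = H' \<and> I = I' \<and> J = J'"
  proof (cases "A = 0")
    case False
    then have "A = 1" "A' = 1" using n A by (auto simp: normal1_def)
    then have "a = 1" using A by simp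
    then show ?thesis using A H I J n \<open>A = 1\<close> \<open>A' = 1\<close> by (auto simp: normal1_def)
  next
    case A0: True
    then have A'0: "A' = 0" using A ae by simp
    show ?thesis
    proof (cases "I = 0 \<and> H = 0")
      case True
      then show ?thesis using A0 A'0 H I J ae n by (auto simp: normal1_def)
    next
      case False
      \<comment> \<open>A coefficient normalized to 1 or -1 is multiplied by the positive number
        a^2, possibly up to the reflection. This leaves \<open>a = 1\<close> or
        \<open>a = -1\<close>, and \<open>0 \<le> J\<close> decides the rest.\<close>
      have "0 < a ^ 2" using ae by simp
      then have "a ^ 2 = 1"
        using False n A0 A'0 ae H I power2_neq_minus_one[of a] by (auto simp: normal1_def)
      then have "a = 1 \<or> a = -1" by (simp add: power2_eq_1_iff)
      then show ?thesis using A0 A'0 H I J n False by (auto simp: normal1_def)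
    qed
  qed
  then show ?thesis by simp
qed

text \<open>The elements of the dihedral group that move the line \<open>x = 0\<close>; \<open>\<kappa>\<close> and \<open>\<sigma>\<close> are signs.\<close>

lemma normal2_rotation_unique:
  assumes \<kappa>: "\<kappa> = 1 \<or> \<kappa> = -1" and \<sigma>: "\<sigma> = 1 \<or> \<sigma> = -1" and a: "a \<noteq> 0"
    and C: "C = - 2 * a * C'" and H: "9/4 * C ^ 2 + H - 3 * \<kappa> * I = - 8 * a ^ 2 * H'"
    and I: "3/4 * C ^ 2 + H + \<kappa> * I = - 8 * \<sigma> * a ^ 2 * I'"
    and J: "9/16 * C ^ 3 + 3/4 * C * (H - \<kappa> * I) + J = - 8 * a ^ 3 * J'"
    and n: "normal2 C H I J" "normal2 C' H' I' J'"
  shows "C = C' \<and> H = H' \<and> I = I' \<and> J = J'"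
proof (cases "C = 0")
  case False
  then have C1: "C = -1" "C' = -1" using n C by (auto simp: normal2_def)
  then have a: "a = -1/2" using C by simp
  have w: "0 \<le> I" "H + I \<le> -3/4" "0 \<le> I'" "H' + I' \<le> -3/4"
    using n C1 by (auto simp: normal2_def)
  \<comment> \<open>In terms of h = H + 3/4 the chamber is 0 \<le> I \<le> -h. A symmetry moving the
    line x = 0 keeps a point in the chamber only if it lies on the wall h = -I, and then it fixes
    that point.\<close>
  show ?thesis using H I J w \<kappa> \<sigma> unfolding C1 a by (auto simp: power2_eq_square power3_eq_cube)
next
  case C0: True
  then have C'0: "C' = 0" using C a by simp
  have a2: "0 < a ^ 2" using a by simp
  show ?thesis
  proof (cases "I = 0")
    case True
    then have "H = 0" using n C0 by (auto simp: normal2_def)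
    then have "H' = 0" "I' = 0" using H I True C0 a \<sigma> by auto
    then show ?thesis using n C0 C'0 True \<open>H = 0\<close> J a by (auto simp: normal2_def)
  next
    case False
    then have I1: "I = -1" and J0: "0 \<le> J" and H1: "-1 \<le> H" "H \<le> 1" using n C0 by (auto simp: normal2_def)
    have "I' \<noteq> 0"
    proof
      assume "I' = 0"
      then have "H' = 0" using n C'0 by (auto simp: normal2_def)
      then show False using H I I1 \<open>I' = 0\<close> C0 \<kappa> by auto
    qed
    then have I'1: "I' = -1" and J'0: "0 \<le> J'" and H'1: "-1 \<le> H'" "H' \<le> 1"
      using n C'0 by (auto simp: normal2_def)
    have b: "- (a ^ 2) \<le> a ^ 2 * H'" "a ^ 2 * H' \<le> a ^ 2"
      using mult_left_mono[OF H'1(1), of "a ^ 2"] mult_left_mono[OF H'1(2), of "a ^ 2"] a2 by auto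
    have HI: "H + 3 * \<kappa> = - 8 * (a ^ 2 * H')" "H - \<kappa> = 8 * \<sigma> * a ^ 2"
      using H I by (auto simp: C0 I1 I'1)
    \<comment> \<open>Stated for arbitrary \<open>s\<close> and \<open>t\<close> in place of a^2 and
      a^2 H', which makes the constraints linear. They are compatible only at the endpoint
      \<open>H = - \<kappa>\<close>.\<close>
    have "s = 1 / 4 \<and> H = - \<kappa>"
      if "H + 3 * \<kappa> = - 8 * t" "H - \<kappa> = 8 * \<sigma> * s" "- s \<le> t" "t \<le> s" "0 < s" for s t
      using that H1 \<kappa> \<sigma> by auto
    from this[OF HI b a2] have "a ^ 2 = 1 / 4 \<and> H = - \<kappa>" .
    then have a14: "a ^ 2 = (1 / 2) ^ 2" and H2: "H = - \<kappa>" by (auto simp: power2_eq_square)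
    have "H' = H" using HI(1) H2 a14 by (simp add: power2_eq_square)
    moreover have "a = 1 / 2 \<or> a = - (1 / 2)" using a14 by (simp only: power2_eq_iff)
    then have "J = J'"
    proof
      assume "a = 1 / 2"
      then have "J = - J'" using J unfolding C0 \<open>a = 1 / 2\<close> by (simp add: power3_eq_cube)
      then show ?thesis using J0 J'0 by linarith
    next
      assume "a = - (1 / 2)"
      then show ?thesis using J unfolding C0 \<open>a = - (1 / 2)\<close> by (simp add: power3_eq_cube)
    qed
    ultimately show ?thesis using C0 C'0 I1 I'1 by simp
  qed
qed

lemma normal2_unique:
  assumes eq: "affine_equiv (cub 1 0 (-1) 0 0 0 C H I J) (cub 1 0 (-1) 0 0 0 C' H' I' J')"
    and n: "normal2 C H I J" "normal2 C' H' I' J'"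
  shows "cub 1 0 (-1) 0 0 0 C H I J = cub 1 0 (-1) 0 0 0 C' H' I' J'"
proof -
  obtain a b p d e q c where
    coeffs: "affine_coeffs a b p d e q c 1 0 (-1) 0 0 C H I J 1 0 (-1) 0 0 0 C' H' I' J'"
    by (rule affine_equivE[OF eq])
  then have E: "a * e \<noteq> b * d" "c \<noteq> 0" "a ^ 3 - a * d ^ 2 - c = 0"
    "3 * a ^ 2 * b - (b * d ^ 2 + 2 * a * d * e) = 0"
    "3 * a * b ^ 2 - (a * e ^ 2 + 2 * b * d * e) + c = 0" "b ^ 3 - b * e ^ 2 = 0"
    "3 * a ^ 2 * p - (2 * a * d * q + d ^ 2 * p) + C * d ^ 2 = 0"
    "6 * a * b * p - (2 * (a * e + b * d) * q + 2 * d * e * p) + 2 * C * d * e = 0"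
    "3 * b ^ 2 * p - (2 * b * e * q + e ^ 2 * p) + C * e ^ 2 - c * C' = 0"
    "3 * a * p ^ 2 - (a * q ^ 2 + 2 * d * p * q) + 2 * C * d * q + H * a + I * d - c * H' = 0"
    "3 * b * p ^ 2 - (b * q ^ 2 + 2 * e * p * q) + 2 * C * e * q + H * b + I * e - c * I' = 0"
    "p ^ 3 - p * q ^ 2 + C * q ^ 2 + H * p + I * q + J - c * J' = 0"
    unfolding affine_coeffs_def by (simp_all add: algebra_simps)
  \<comment> \<open>(b, e) is the image of the direction of the line x = 0, so it lies on one of the
    three lines of the cubic form.\<close>
  have "b * (b - e) * (b + e) = 0" using E(6) by (simp add: algebra_simps power2_eq_square power3_eq_cube)
  then have "b = 0 \<or> e = 1 * b \<or> e = -1 * b" by (auto simp: eq_neg_iff_add_eq_0 add.commute)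
  then consider "b = 0" | \<kappa> where "b \<noteq> 0" "e = \<kappa> * b" "\<kappa> = 1 \<or> \<kappa> = -1" by blast
  then have "C = C' \<and> H = H' \<and> I = I' \<and> J = J'"
  proof cases
    case b: 1
    then have ae: "a \<noteq> 0" "e \<noteq> 0" using E(1) by auto
    then have d: "d = 0" using E(4) b by simp
    have p: "p = 0" using E(7) d ae by simp
    have q: "q = 0" using E(8) b d ae by simp
    have c: "c = a ^ 3" using E(3) d by simp
    have e2: "e ^ 2 = a ^ 2" using E(5) b c ae by (simp add: power2_eq_square power3_eq_cube)
    then have e: "e = a \<or> e = - a" by (simp add: power2_eq_iff)
    have C: "C = a * C'"
      using E(9) b d p q c ae e2 by (simp add: power2_eq_square power3_eq_cube)
    have H: "H = a ^ 2 * H'" and J: "J = a ^ 3 * J'"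
      using E(10,12) b d p q c ae by (simp_all add: power2_eq_square power3_eq_cube)
    have I: "I = a ^ 2 * I' \<or> I = - (a ^ 2 * I')"
      using e E(11) b p q c ae scaled_reflection[of a e I I'] by auto
    show ?thesis
    proof (cases "C = 0")
      case False
      then have "C = -1" "C' = -1" using n C by (auto simp: normal2_def)
      then have "a = 1" using C by simp
      then show ?thesis using C H I J n \<open>C = -1\<close> \<open>C' = -1\<close> by (auto simp: normal2_def)
    next
      case C0: True
      then have C'0: "C' = 0" using C ae by simp
      show ?thesis
      proof (cases "I = 0")
        case True
        then show ?thesis using C0 C'0 H I J ae n by (auto simp: normal2_def)
      next
        case False
        have "0 < a ^ 2" using ae by simp
        then have "a ^ 2 = 1"
          using False n C0 C'0 ae I power2_neq_minus_one[of a] by (auto simp: normal2_def)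
        then have "a = 1 \<or> a = -1" by (simp add: power2_eq_1_iff)
        then show ?thesis using C0 C'0 H I J n False by (auto simp: normal2_def)
      qed
    qed
  next
    case 2
    have \<kappa>: "\<kappa> ^ 2 - 1 = 0" and e: "e - \<kappa> * b = 0" using 2 by auto
    \<comment> \<open>On e = \<kappa> b the vanishing coefficient of x^2 y factors, and the second
      factor cannot vanish since the map is invertible.\<close>
    have "b * ((3 * a + \<kappa> * d) * (a - \<kappa> * d)) = 0" using E(4) e \<kappa> by algebra
    moreover have "a - \<kappa> * d \<noteq> 0"
    proof
      assume "a - \<kappa> * d = 0"
      then have "a * e - b * d = 0" using e \<kappa> by algebra
      then show False using E(1) by simp
    qed
    ultimately have "3 * a + \<kappa> * d = 0" using 2(1) by simp
    then have d: "d + 3 * \<kappa> * a = 0" using \<kappa> by algebra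
    have c: "c + 8 * a ^ 3 = 0" using E(3) d \<kappa> by algebra
    have a: "a \<noteq> 0" using c E(2) by auto
    have "a * (b ^ 2 - a ^ 2) = 0" using E(5) e d c \<kappa> by algebra
    then have "b ^ 2 = a ^ 2" using a by simp
    then have "b = 1 * a \<or> b = -1 * a" by (simp add: power2_eq_iff)
    then obtain \<sigma> where "b = \<sigma> * a" and \<sigma>': "\<sigma> = 1 \<or> \<sigma> = -1" by blast
    then have b: "b - \<sigma> * a = 0" and \<sigma>: "\<sigma> ^ 2 - 1 = 0" by auto
    \<comment> \<open>The vanishing coefficients of x^2 and xy are linear equations for the
      translation; their solution is p = 3C/4, q = -3\<kappa>C/4.\<close>
    have "a ^ 2 * (- 6 * p + 6 * \<kappa> * q + 9 * C) = 0" using E(7) d \<kappa> by algebra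
    then have pq1: "- 6 * p + 6 * (\<kappa> * q) + 9 * C = 0" using a by simp
    have "\<sigma> * a ^ 2 * (12 * p + 4 * \<kappa> * q - 6 * C) = 0" using E(8) b d e \<kappa> by algebra
    then have pq2: "12 * p + 4 * (\<kappa> * q) - 6 * C = 0" using a \<sigma>' by auto
    have p: "4 * p - 3 * C = 0" and \<kappa>q: "4 * (\<kappa> * q) + 3 * C = 0" using pq1 pq2 by linarith+
    have q: "4 * q + 3 * \<kappa> * C = 0" using \<kappa>q \<kappa> by algebra
    have "a ^ 2 * (4 * C + 8 * a * C') = 0" using E(9) b e c p q \<kappa> \<sigma> by algebra
    then have C: "C = - 2 * a * C'" using a by simp
    have "a * (9 / 4 * C ^ 2 + H - 3 * \<kappa> * I + 8 * a ^ 2 * H') = 0"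
      using E(10) d c p q \<kappa> by algebra
    then have H: "9 / 4 * C ^ 2 + H - 3 * \<kappa> * I = - 8 * a ^ 2 * H'" using a by simp
    have "a * (3 / 4 * C ^ 2 + H + \<kappa> * I + 8 * \<sigma> * a ^ 2 * I') = 0"
      using E(11) b e c p q \<kappa> \<sigma> by algebra
    then have I: "3 / 4 * C ^ 2 + H + \<kappa> * I = - 8 * \<sigma> * a ^ 2 * I'" using a by simp
    have "9 / 16 * C ^ 3 + 3 / 4 * C * (H - \<kappa> * I) + J + 8 * a ^ 3 * J' = 0"
      using E(12) c p q \<kappa> by algebra
    then have J: "9 / 16 * C ^ 3 + 3 / 4 * C * (H - \<kappa> * I) + J = - 8 * a ^ 3 * J'" by simp
    show ?thesis by (rule normal2_rotation_unique[OF 2(3) \<sigma>' a C H I J n])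
  qed
  then show ?thesis by simp
qed

text \<open>The double line x = 0 and the simple line y = 0 are each preserved, and the missing x^2
  and xy terms exclude translations. The map is diagonal with \<open>c = a ^ 2 * e\<close>. If
  \<open>C = 1\<close> then \<open>e = a ^ 2\<close>, so \<open>H\<close>, \<open>I\<close>,
  \<open>J\<close> have weights 3, 2, 4 and the signs of \<open>I\<close> and \<open>J\<close> are
  invariant.\<close>

lemma normal3_unique:
  assumes eq: "affine_equiv (cub 0 1 0 0 0 0 C H I J) (cub 0 1 0 0 0 0 C' H' I' J')"
    and n: "normal3 C H I J" "normal3 C' H' I' J'"
  shows "cub 0 1 0 0 0 0 C H I J = cub 0 1 0 0 0 0 C' H' I' J'"
proof -
  obtain a b p d e q c where
    coeffs: "affine_coeffs a b p d e q c 0 1 0 0 0 C H I J 0 1 0 0 0 0 C' H' I' J'"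
    by (rule affine_equivE[OF eq])
  then have E: "a * e \<noteq> b * d" "c \<noteq> 0" "a ^ 2 * d = 0"
    "2 * a * b * d + a ^ 2 * e = c" "b ^ 2 * d + 2 * a * b * e = 0" "b ^ 2 * e = 0"
    "2 * a * d * p + a ^ 2 * q + C * d ^ 2 = 0"
    "2 * (a * e + b * d) * p + 2 * a * b * q + 2 * C * d * e = 0"
    "2 * b * e * p + b ^ 2 * q + C * e ^ 2 = c * C'"
    "2 * a * p * q + d * p ^ 2 + 2 * C * d * q + H * a + I * d = c * H'"
    "2 * b * p * q + e * p ^ 2 + 2 * C * e * q + H * b + I * e = c * I'"
    "p ^ 2 * q + C * q ^ 2 + H * p + I * q + J = c * J'"
    unfolding affine_coeffs_def by (simp_all add: algebra_simps)
  have b: "b = 0"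
  proof (rule ccontr)
    assume "b \<noteq> 0"
    then show False using E(1,5,6) by auto
  qed
  then have ae: "a \<noteq> 0" "e \<noteq> 0" using E(1) by auto
  then have d: "d = 0" using E(3) by simp
  have c: "c = a ^ 2 * e" using E(4) b by simp
  have q: "q = 0" using E(7) d ae by simp
  have p: "p = 0" using E(8) d b ae by simp
  have C: "C * e = a ^ 2 * C'" using E(9) b c ae by (simp add: power2_eq_square)
  have H: "H = a * e * H'" using E(10) d q p c ae by (simp add: power2_eq_square)
  have I: "I = a ^ 2 * I'" using E(11) b q p c ae by (simp add: power2_eq_square)
  have J: "J = a ^ 2 * e * J'" using E(12) q p c by simp
  have a2: "0 < a ^ 2" using ae by simp
  have "C = C' \<and> H = H' \<and> I = I' \<and> J = J'"
  proof (cases "C = 0")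
    case False
    then have C1: "C = 1" "C' = 1" using n C ae by (auto simp: normal3_def)
    then have e: "e = a ^ 2" using C by simp
    have H3: "H = a ^ 3 * H'" and J4: "J = a ^ 4 * J'"
      using H J e by (simp_all add: power_numeral_reduce)
    show ?thesis
    proof (cases "H = 0")
      case False
      then have "H = -1" "H' = -1" using n C1 H3 by (auto simp: normal3_def)
      then have "a ^ 3 = 1 ^ 3" using H3 by simp
      then have "a = 1" by (metis odd_real_root_power_cancel odd_numeral)
      then show ?thesis using C1 H3 I J4 by simp
    next
      case H0: True
      then have H'0: "H' = 0" using H3 ae by simp
      show ?thesis
      proof (cases "I = 0")
        case True
        moreover have "a ^ 4 \<noteq> -1"
          using zero_le_even_power[of 4 a] by (metis even_numeral neg_0_le_iff_le not_one_le_zero)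
        ultimately show ?thesis using n C1 H0 H'0 I J4 ae
          by (auto simp: normal3_def)
      next
        case False
        have "s = 1 \<and> I = I'" if "I = s * I'" "0 < s" for s
          using that n C1 H0 H'0 False by (auto simp: normal3_def)
        then have "a ^ 2 = 1 \<and> I = I'" using I a2 by blast
        moreover from this have "a ^ 4 = 1" by (metis power_one power_mult num_double numeral_times_numeral)
        ultimately show ?thesis using C1 H0 H'0 J4 by simp
      qed
    qed
  next
    case C0: True
    then have C'0: "C' = 0" using C ae by simp
    show ?thesis
    proof (cases "I = 0")
      case I0: True
      then have "I' = 0" using I ae by simp
      then show ?thesis using n C0 C'0 I0 H J ae by (auto simp: normal3_def)
    next
      case False
      then have a21: "a ^ 2 = 1" "I = I'" using n C0 C'0 I power2_neq_minus_one[of a] by (auto simp: normal3_def)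
      show ?thesis
      proof (cases "H = 0")
        case True
        then have "H' = 0" using H ae by simp
        then show ?thesis using True n C0 C'0 a21 False J ae by (auto simp: normal3_def)
      next
        case False
        then have H1: "H = -1" "H' = -1" using n C0 C'0 H ae by (auto simp: normal3_def)
        have "a = 1 \<or> a = -1" using a21 by (simp add: power2_eq_1_iff)
        then have "e = 1 \<or> e = -1" using H H1 by auto
        then show ?thesis using n C0 C'0 a21 J H1 \<open>I \<noteq> 0\<close> by (auto simp: normal3_def)
      qed
    qed
  qed
  then show ?thesis by simp
qed

text \<open>Comparing y^2 shows that the target is of Weierstrass type too, with
  \<open>e ^ 2 = a ^ 3\<close>. Hence \<open>a\<close> is positive and not even the odd-weight
  coefficient \<open>J\<close> can change sign.\<close>

lemma weierstrass_unique:
  assumes eq: "affine_equiv (cub 1 0 0 0 0 B C H I J) (cub 1 0 0 0 0 B' C' H' I' J')"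
    and n: "weierstrass B C H I J" "normal4 B' C' H' I' J'"
  shows "cub 1 0 0 0 0 B C H I J = cub 1 0 0 0 0 B' C' H' I' J'"
proof -
  have BCI: "B = 0" "C = -1" "I = 0" using n(1) by (auto simp: weierstrass_def)
  obtain a b p d e q c where
    coeffs: "affine_coeffs a b p d e q c 1 0 0 0 B C H I J 1 0 0 0 0 B' C' H' I' J'"
    by (rule affine_equivE[OF eq])
  then have b: "b = 0" by (simp add: affine_coeffs_def)
  then have E: "a * e \<noteq> b * d" "c \<noteq> 0" "a ^ 3 = c" "b = 0"
    "3 * a ^ 2 * p - d ^ 2 = 0"
    "6 * a * b * p - 2 * d * e = c * B'"
    "3 * b ^ 2 * p - e ^ 2 = c * C'"
    "3 * a * p ^ 2 - 2 * d * q + H * a = c * H'"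
    "3 * b * p ^ 2 - 2 * e * q + H * b = c * I'"
    "p ^ 3 - q ^ 2 + H * p + J = c * J'"
    using coeffs unfolding affine_coeffs_def by (simp_all add: BCI algebra_simps)
  have ae: "a \<noteq> 0" "e \<noteq> 0" using E(1,4) by auto
  have "C' \<noteq> 0" using E(4,7) ae by auto
  then have w: "weierstrass B' C' H' I' J'" using n(2) by (auto simp: normal4_def univariate_def y_linear_def)
  then have BCI': "B' = 0" "C' = -1" "I' = 0" by (auto simp: weierstrass_def)
  have d: "d = 0" using E(4,6) BCI' ae by simp
  have p: "p = 0" using E(5) d ae by simp
  have q: "q = 0" using E(9) E(4) BCI' ae by simp
  have "e ^ 2 = a ^ 3" using E(3,4,7) BCI' by simp
  then have "0 < a ^ 3" using ae by (metis zero_less_power2)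
  then have a: "0 < a" by (simp add: zero_less_power_eq)
  have "a * H = a * (a ^ 2 * H')"
    using E(8) d q p by (simp add: E(3)[symmetric] power2_eq_square power3_eq_cube mult_ac)
  then have H: "H = a ^ 2 * H'" using a by simp
  have J: "J = a ^ 3 * J'" using E(3,10) d q p by simp
  have a2: "0 < a ^ 2" using a by simp
  have "H = H' \<and> J = J'"
  proof (cases "H = 0")
    case True
    have "H' = 0" using True H a by simp
    moreover have "J = J'" if "J = s * J'" "0 < s" for s
      using that True \<open>H' = 0\<close> n(1) w by (auto simp: weierstrass_def)
    from this[OF J \<open>0 < a ^ 3\<close>] have "J = J'" .
    ultimately show ?thesis using True by simp
  next
    case False
    then have "a ^ 2 = 1" "H = H'"
      using H power2_neq_minus_one[of a] n(1) w by (auto simp: weierstrass_def)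
    then show ?thesis using J a by (auto simp: power2_eq_1_iff)
  qed
  then show ?thesis using BCI BCI' by simp
qed

text \<open>If x divides the target form, its line is the only real one, and the quadratic cofactor
  stays definite, so its outer coefficients have equal sign. In the other three lists this product
  is -1 or 0.\<close>

lemma affine_equiv_one_real_line:
  assumes "affine_equiv (cub 1 0 1 0 A B C H I J) (cub \<alpha> \<beta> \<gamma> 0 A' B' C' H' I' J')"
  shows "0 < \<alpha> * \<gamma>"
proof -
  obtain a b p d e q c where
    "affine_coeffs a b p d e q c 1 0 1 A B C H I J \<alpha> \<beta> \<gamma> 0 A' B' C' H' I' J'"
    by (rule affine_equivE[OF assms])
  then have E: "a * e \<noteq> b * d" "a ^ 3 + a * d ^ 2 = c * \<alpha>"
    "3 * a * b ^ 2 + (a * e ^ 2 + 2 * b * d * e) = c * \<gamma>" "b ^ 3 + b * e ^ 2 = 0"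
    unfolding affine_coeffs_def by simp_all
  have "b * (b ^ 2 + e ^ 2) = 0" using E(4) by (simp add: algebra_simps power2_eq_square power3_eq_cube)
  then have b: "b = 0" by (auto simp: sum_power2_eq_zero_iff)
  then have ae: "a \<noteq> 0" "e \<noteq> 0" using E(1) by auto
  have "c ^ 2 * (\<alpha> * \<gamma>) = (c * \<alpha>) * (c * \<gamma>)" by (simp add: power2_eq_square)
  also have "\<dots> = (a * e) ^ 2 * (a ^ 2 + d ^ 2)"
    unfolding E(2,3)[symmetric] b by (simp add: algebra_simps power2_eq_square power3_eq_cube)
  also have "\<dots> > 0" using ae by (simp add: sum_power2_gt_zero_iff)
  finally show ?thesis by (simp add: zero_less_mult_iff not_less[symmetric])
qed

text \<open>The target form is divisible by x^2, while x (x - y) (x + y) has three distinct lines: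
  along (b, e) the form and its derivative in direction (a, d) would both vanish.\<close>

lemma affine_equiv_three_real_lines:
  "\<not> affine_equiv (cub 1 0 (-1) 0 A B C H I J) (cub \<alpha> \<beta> 0 0 A' B' C' H' I' J')"
proof
  assume "affine_equiv (cub 1 0 (-1) 0 A B C H I J) (cub \<alpha> \<beta> 0 0 A' B' C' H' I' J')"
  then obtain a b p d e q c where
    "affine_coeffs a b p d e q c 1 0 (-1) A B C H I J \<alpha> \<beta> 0 0 A' B' C' H' I' J'"
    by (rule affine_equivE)
  then have E: "a * e \<noteq> b * d"
    "3 * a * b ^ 2 - (a * e ^ 2 + 2 * b * d * e) = 0" "b ^ 3 - b * e ^ 2 = 0"
    unfolding affine_coeffs_def by (simp_all add: algebra_simps)
  have "b * ((b - e) * (b + e)) = 0" using E(3) by algebra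
  then consider "b = 0" | "b \<noteq> 0" "b - e = 0" | "b \<noteq> 0" "b + e = 0" by fastforce
  then show False
  proof cases
    case 1
    then show False using E(1,2) by auto
  next
    case 2
    have "b * (a * e - b * d) = 0" using 2(2) E(2) by algebra
    then show False using 2(1) E(1) by simp
  next
    case 3
    have "b * (a * e - b * d) = 0" using 3(2) E(2) by algebra
    then show False using 3(1) E(1) by simp
  qed
qed

text \<open>The target has a triple line, whereas x^2 y has two distinct ones.\<close>

lemma affine_equiv_double_line:
  "\<not> affine_equiv (cub 0 1 0 0 A B C H I J) (cub 1 0 0 0 A' B' C' H' I' J')"
proof
  assume "affine_equiv (cub 0 1 0 0 A B C H I J) (cub 1 0 0 0 A' B' C' H' I' J')"
  then obtain a b p d e q c where
    "affine_coeffs a b p d e q c 0 1 0 A B C H I J 1 0 0 0 A' B' C' H' I' J'"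
    by (rule affine_equivE)
  then have E: "a * e \<noteq> b * d"
    "2 * a * b * d + a ^ 2 * e = 0" "b ^ 2 * d + 2 * a * b * e = 0" "b = 0 \<or> e = 0"
    unfolding affine_coeffs_def by simp_all
  then show False by auto
qed

text \<open>Q does not occur in f(P, Q), so nothing makes it affine. The degree of P^3 + H P + J
  makes P affine, and comparing coefficients with P alone is enough.\<close>

lemma univariate_unique:
  assumes eq: "aut_equiv (cub 1 0 0 0 0 B C H I J) (cub 1 0 0 0 0 B' C' H' I' J')"
    and n: "univariate B C H I J" "normal4 B' C' H' I' J'"
  shows "cub 1 0 0 0 0 B C H I J = cub 1 0 0 0 0 B' C' H' I' J'"
proof -
  let ?f = "cub 1 0 0 0 0 B C H I J" and ?g = "cub 1 0 0 0 0 B' C' H' I' J'"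
  have BCI: "B = 0" "C = 0" "I = 0" using n(1) by (auto simp: univariate_def)
  have "total_degree ?g = 3" by (rule total_degree_cub) simp
  then obtain \<phi> c where \<phi>: "\<phi> \<in> ring_automorphisms" and c: "c \<noteq> 0"
    and \<phi>f: "\<phi> ?f = cst c * ?g" and t3: "total_degree (\<phi> ?f) = 3"
    using aut_equivE[OF eq] by blast
  define P where "P = \<phi> vx"
  have pos: "1 \<le> total_degree P"
    using aut_vars_total_degree_pos[OF \<phi>] by (simp add: P_def)
  then have top: "total_degree (P ^ 3) = 3 * total_degree P" by (intro total_degree_power) auto
  have "total_degree (cst H * P + cst J) \<le> total_degree P" by (intro total_degree_bounds) auto
  then have "total_degree (P ^ 3 + (cst H * P + cst J)) = 3 * total_degree P"
    unfolding top[symmetric] using top pos by (intro total_degree_add_eq) linarith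
  moreover have "\<phi> ?f = P ^ 3 + (cst H * P + cst J)"
    by (simp add: aut_cub[OF \<phi>] P_def BCI cst_simps)
  ultimately have "total_degree P \<le> 1" using t3 by simp
  then obtain a b p where P: "P = affine a b p" using total_degree_le_1D by blast
  have "ev (cub (a ^ 3) (3 * a ^ 2 * b) (3 * a * b ^ 2) (b ^ 3) (3 * a ^ 2 * p) (6 * a * b * p) (3 * b ^ 2 * p)
      (3 * a * p ^ 2 + H * a) (3 * b * p ^ 2 + H * b) (p ^ 3 + H * p + J)) x y = c * ev ?g x y" for x y
  proof -
    have "c * ev ?g x y = (a * x + b * y + p) ^ 3 + H * (a * x + b * y + p) + J"
      using arg_cong[OF \<phi>f, of "\<lambda>h. ev h x y"] ev_aut[OF \<phi>, of ?f x y]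
      by (simp add: P_def[symmetric] P BCI)
    also have "\<dots> = ev (cub (a ^ 3) (3 * a ^ 2 * b) (3 * a * b ^ 2) (b ^ 3) (3 * a ^ 2 * p) (6 * a * b * p)
        (3 * b ^ 2 * p) (3 * a * p ^ 2 + H * a) (3 * b * p ^ 2 + H * b) (p ^ 3 + H * p + J)) x y"
      unfolding ev_cub by algebra
    finally show ?thesis by simp
  qed
  from cub_proportionalD[OF this] have E: "a ^ 3 = c" "b = 0" "p = 0" "B' = 0" "C' = 0" "I' = 0"
    "H * a = c * H'" "J = c * J'"
    using c by auto
  have a: "a \<noteq> 0" using E(1) c by auto
  have "a * H = a * (a ^ 2 * H')" using E(7) by (simp add: E(1)[symmetric] power2_eq_square power3_eq_cube mult_ac)
  then have H: "H = a ^ 2 * H'" using a by simp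
  have J: "J = a ^ 3 * J'" using E by simp
  have n': "univariate B' C' H' I' J'"
    using n(2) E by (auto simp: normal4_def weierstrass_def y_linear_def)
  have "H = H' \<and> J = J'"
  proof (cases "H = 0")
    case True
    then have "H' = 0" using H a by simp
    then show ?thesis using True J a n(1) n' by (auto simp: univariate_def)
  next
    case False
    then have "a ^ 2 = 1" "H = H'"
      using H power2_neq_minus_one[of a] n(1) n' by (auto simp: univariate_def)
    moreover from this have "a = 1 \<or> a = -1" by (simp add: power2_eq_1_iff)
    ultimately show ?thesis using J n(1) n' False by (auto simp: univariate_def)
  qed
  then show ?thesis by (simp add: BCI E(4-6))
qed

text \<open>Gauss's lemma in degree one: one factor is free of y, so it divides both r and s, hence
  their Bezout combination 1.\<close>

lemma linear_in_y_irreducible: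
  fixes r s u v :: "real poly"
  assumes UV: "U * V = [:r, s:]" and "s \<noteq> 0" and coprime: "u * r + v * s = 1"
  shows "(\<exists>k. U = cst k) \<or> (\<exists>k. V = cst k)"
proof -
  have cst: "\<exists>k. W = cst k" if WX: "W * X = [:r, s:]" and W: "degree W = 0" for W X
  proof -
    obtain w where w: "W = [:w:]" using W by (rule degree_eq_zeroE)
    have "r = w * coeff X 0" "s = w * coeff X 1"
      using arg_cong[OF WX, of "\<lambda>p. coeff p 0"] arg_cong[OF WX, of "\<lambda>p. coeff p 1"] by (simp_all add: w)
    then have "w * (u * coeff X 0 + v * coeff X 1) = 1"
      using coprime by (simp add: algebra_simps)
    then have "[:w:] * [:u * coeff X 0 + v * coeff X 1:] = 1" by (simp add: one_pCons mult.commute)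
    then show ?thesis using w bipoly_unit_cst by metis
  qed
  have "U \<noteq> 0" "V \<noteq> 0" using UV \<open>s \<noteq> 0\<close> by auto
  then have "degree U + degree V = 1"
    using UV \<open>s \<noteq> 0\<close> by (simp add: degree_mult_eq[symmetric])
  then consider "degree U = 0" | "degree V = 0" by linarith
  then show ?thesis using cst[of U V] cst[of V U] UV by cases (auto simp: mult.commute)
qed

text \<open>f - J = x (x^2 - y) splits into nonconstant factors and \<open>\<phi>\<close> fixes J,
  so c g - J would have to split as well. The premise \<open>irr\<close> makes it irreducible for
  every c.\<close>

lemma not_aut_equiv_reducible:
  assumes eq: "aut_equiv (cub 1 0 0 0 0 (-1) 0 0 0 J) g"
    and irr: "\<And>c. c \<noteq> 0 \<Longrightarrow> \<exists>r s u v. cst c * g - cst J = [:r, s:] \<and> s \<noteq> 0 \<and> u * r + v * s = 1"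
  shows False
proof -
  let ?f = "cub 1 0 0 0 0 (-1) 0 0 0 J"
  obtain \<phi> c where \<phi>: "\<phi> \<in> ring_automorphisms" and c: "c \<noteq> 0" and \<phi>f: "\<phi> ?f = cst c * g"
    using eq unfolding aut_equiv_def by blast
  obtain r s u v where rs: "cst c * g - cst J = [:r, s:]" "s \<noteq> 0" "u * r + v * s = 1"
    using irr[OF c] by blast
  let ?h = "vx ^ 2 + cst (-1) * vy"
  have "\<phi> (vx * ?h + cst J) = cst c * g"
    unfolding \<phi>f[symmetric] by (rule arg_cong[of _ _ \<phi>], rule bipoly_eqI)
      (simp add: algebra_simps power2_eq_square power3_eq_cube)
  then have "\<phi> vx * \<phi> ?h = [:r, s:]"
    unfolding rs(1)[symmetric] by (simp add: aut_add[OF \<phi>] aut_mult[OF \<phi>] aut_cst[OF \<phi>])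
  from linear_in_y_irreducible[OF this rs(2,3)]
  obtain k where "\<phi> vx = \<phi> (cst k) \<or> \<phi> ?h = \<phi> (cst k)" using aut_cst[OF \<phi>] by metis
  then have "vx = cst k \<or> ?h = cst k" using aut_inj[OF \<phi>] by simp
  then show False by (simp add: vx_def vy_def cst_def power2_eq_square)
qed

lemma not_aut_equiv_coordinate:
  "\<not> aut_equiv (cub 1 0 0 0 0 (-1) 0 0 0 J) (cub 1 0 0 0 0 0 0 0 (-1) 0)"
proof
  assume eq: "aut_equiv (cub 1 0 0 0 0 (-1) 0 0 0 J) (cub 1 0 0 0 0 0 0 0 (-1) 0)"
  show False
  proof (rule not_aut_equiv_reducible[OF eq], intro exI conjI)
    fix c :: real assume c: "c \<noteq> 0"
    show "cst c * cub 1 0 0 0 0 0 0 0 (-1) 0 - cst J = [:[:- J, 0, 0, c:], [:- c:]:]"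
      by (simp add: cst_def cub_def)
    show "[:- c:] \<noteq> 0" using c by simp
    show "0 * [:- J, 0, 0, c:] + [:- 1 / c:] * [:- c:] = 1" using c by (simp add: one_pCons)
  qed
qed

text \<open>The first cubic splits after subtracting 1, but c (x^3 - xy) - 1 is irreducible for
  every nonzero c: its coefficient of y vanishes only at x = 0, where the rest is -1.\<close>

lemma not_aut_equiv_split:
  "\<not> aut_equiv (cub 1 0 0 0 0 (-1) 0 0 0 1) (cub 1 0 0 0 0 (-1) 0 0 0 0)"
proof
  assume eq: "aut_equiv (cub 1 0 0 0 0 (-1) 0 0 0 1) (cub 1 0 0 0 0 (-1) 0 0 0 0)"
  show False
  proof (rule not_aut_equiv_reducible[OF eq], intro exI conjI)
    fix c :: real assume c: "c \<noteq> 0"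
    show "cst c * cub 1 0 0 0 0 (-1) 0 0 0 0 - cst 1 = [:[:- 1, 0, 0, c:], [:0, - c:]:]"
      by (simp add: cst_def cub_def)
    show "[:0, - c:] \<noteq> 0" using c by simp
    show "[:- 1:] * [:- 1, 0, 0, c:] + [:0, 0, - 1:] * [:0, - c:] = 1" by (simp add: one_pCons)
  qed
qed

lemma normal4_unique:
  assumes eq: "aut_equiv (cub 1 0 0 0 0 B C H I J) (cub 1 0 0 0 0 B' C' H' I' J')"
    and n: "normal4 B C H I J" "normal4 B' C' H' I' J'"
  shows "cub 1 0 0 0 0 B C H I J = cub 1 0 0 0 0 B' C' H' I' J'"
proof -
  have W: "cub 1 0 0 0 0 B C H I J = cub 1 0 0 0 0 B' C' H' I' J'"
    if "weierstrass B C H I J" "normal4 B' C' H' I' J'"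
      "aut_equiv (cub 1 0 0 0 0 B C H I J) (cub 1 0 0 0 0 B' C' H' I' J')" for B C H I J B' C' H' I' J'
  proof -
    have "B = 0" "C = -1" "I = 0" using that(1) by (auto simp: weierstrass_def)
    then have "affine_equiv (cub 1 0 0 0 0 B C H I J) (cub 1 0 0 0 0 B' C' H' I' J')"
      using aut_equiv_weierstrass_affine that(3) by blast
    then show ?thesis using weierstrass_unique that(1,2) by blast
  qed
  note sym = aut_equiv_sym[OF eq]
  \<comment> \<open>By symmetry it suffices that one side is Weierstrass or univariate; otherwise
    both sides are linear in y.\<close>
  consider "weierstrass B C H I J" | "weierstrass B' C' H' I' J'" | "univariate B C H I J" |
    "univariate B' C' H' I' J'" | "y_linear B C H I J" "y_linear B' C' H' I' J'"
    using n unfolding normal4_def by blast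
  then show ?thesis
  proof cases
    case 1
    then show ?thesis using W n(2) eq by blast
  next
    case 2
    then show ?thesis using W[OF _ n(1) sym] by simp
  next
    case 3
    then show ?thesis using univariate_unique[OF eq] n(2) by blast
  next
    case 4
    then show ?thesis using univariate_unique[OF sym _ n(1)] by simp
  next
    case 5
    then show ?thesis
      using eq sym not_aut_equiv_coordinate not_aut_equiv_split unfolding y_linear_def
      by (elim conjE disjE) simp_all
  qed
qed

lemma list_L_unique:
  assumes "f \<in> list_L" "g \<in> list_L" "aut_equiv f g"
  shows "f = g"
proof -
  have deg: "total_degree h = 3" if "h \<in> list_L" for h
    using that unfolding list_L_def Un_iff list_L1_iff list_L2_iff list_L3_iff list_L4_iff
    by (auto intro!: total_degree_cub)
  \<comment> \<open>The obstructions between distinct leading forms are one-directional, so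
    \<open>f\<close> is taken from the earlier list; symmetry of the equivalence covers the opposite
    order.\<close>
  have later: "f = g" if f: "f \<in> list_L1 \<union> list_L2 \<union> list_L3" and fg: "aut_equiv f g"
    and g: "f \<in> list_L1 \<and> g \<in> list_L \<or> f \<in> list_L2 \<and> g \<in> list_L2 \<union> list_L3 \<union> list_L4 \<or> f \<in> list_L3 \<and> g \<in> list_L3 \<union> list_L4"
  for f g
  proof -
    have "total_degree g = 3" using g deg by (auto simp: list_L_def)
    note g3 = this
    consider "f \<in> list_L1" "g \<in> list_L" | "f \<in> list_L2" "g \<in> list_L2 \<union> list_L3 \<union> list_L4"
      | "f \<in> list_L3" "g \<in> list_L3 \<union> list_L4"
      using g by blast
    then show ?thesis
    proof cases
      case 1
      then obtain A H I J where f: "f = cub 1 0 1 0 A 0 0 H I J" "normal1 A H I J"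
        unfolding list_L1_iff by blast
      have aff: "affine_equiv f g" using aut_equiv_L1_affine fg g3 unfolding f(1) by blast
      consider "g \<in> list_L1" | "g \<in> list_L2" | "g \<in> list_L3" | "g \<in> list_L4"
        using 1(2) unfolding list_L_def by blast
      then show ?thesis
      proof cases
        case 1
        then show ?thesis using aff f normal1_unique unfolding list_L1_iff by blast
      next
        case 2
        then show ?thesis using aff affine_equiv_one_real_line unfolding f(1) list_L2_iff by fastforce
      next
        case 3
        then show ?thesis using aff affine_equiv_one_real_line unfolding f(1) list_L3_iff by fastforce
      next
        case 4
        then show ?thesis using aff affine_equiv_one_real_line unfolding f(1) list_L4_iff by fastforce
      qed
    next
      case 2
      then obtain C H I J where f: "f = cub 1 0 (-1) 0 0 0 C H I J" "normal2 C H I J"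
        unfolding list_L2_iff by blast
      have aff: "affine_equiv f g" using aut_equiv_L2_affine fg g3 unfolding f(1) by blast
      consider "g \<in> list_L2" | "g \<in> list_L3" | "g \<in> list_L4" using 2(2) by blast
      then show ?thesis
      proof cases
        case 1
        then show ?thesis using aff f normal2_unique unfolding list_L2_iff by blast
      next
        case 2
        then show ?thesis using aff affine_equiv_three_real_lines unfolding f(1) list_L3_iff by blast
      next
        case 3
        then show ?thesis using aff affine_equiv_three_real_lines unfolding f(1) list_L4_iff by blast
      qed
    next
      case 3
      then obtain C H I J where f: "f = cub 0 1 0 0 0 0 C H I J" "normal3 C H I J"
        unfolding list_L3_iff by blast
      have "C = 0 \<or> C = 1" using f(2) unfolding normal3_def by blast
      then have aff: "affine_equiv f g" using aut_equiv_L3_affine fg g3 unfolding f(1) by blast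
      consider "g \<in> list_L3" | "g \<in> list_L4" using 3(2) by blast
      then show ?thesis
      proof cases
        case 1
        then show ?thesis using aff f normal3_unique unfolding list_L3_iff by blast
      next
        case 2
        then show ?thesis using aff affine_equiv_double_line unfolding f(1) list_L4_iff by blast
      qed
    qed
  qed
  have "f = g" if "f \<in> list_L4" "g \<in> list_L4"
    using that assms(3) normal4_unique unfolding list_L4_iff by blast
  moreover have "f = g" if "\<not> (f \<in> list_L4 \<and> g \<in> list_L4)"
    using that assms later[of f g] later[of g f] aut_equiv_sym[of f g] unfolding list_L_def by blast
  ultimately show ?thesis by blast
qed

section \<open>Existence of normal forms\<close>

lemma aut_equivI_coeffs:
  assumes "affine_coeffs a b p d e q c \<alpha> \<beta> \<gamma> A B C H I J \<alpha>' \<beta>' \<gamma>' \<delta>' A' B' C' H' I' J'"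
  shows "aut_equiv (cub \<alpha> \<beta> \<gamma> 0 A B C H I J) (cub \<alpha>' \<beta>' \<gamma>' \<delta>' A' B' C' H' I' J')"
proof (rule aut_equivI_affine)
  show "a * e \<noteq> b * d" "c \<noteq> 0" using assms unfolding affine_coeffs_def by blast+
  fix x y
  have "ev (cub \<alpha> \<beta> \<gamma> 0 A B C H I J) (a * x + b * y + p) (d * x + e * y + q) =
      ev (cub (c * \<alpha>') (c * \<beta>') (c * \<gamma>') (c * \<delta>') (c * A') (c * B') (c * C') (c * H') (c * I') (c * J')) x y"
    using assms unfolding ev_cub_affine affine_coeffs_def by simp
  also have "\<dots> = c * ev (cub \<alpha>' \<beta>' \<gamma>' \<delta>' A' B' C' H' I' J') x y"
    by (simp add: algebra_simps)
  finally show "ev (cub \<alpha> \<beta> \<gamma> 0 A B C H I J) (a * x + b * y + p) (d * x + e * y + q) =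
      c * ev (cub \<alpha>' \<beta>' \<gamma>' \<delta>' A' B' C' H' I' J') x y" .
qed

lemma aut_equiv_refl: "aut_equiv f f"
  by (rule aut_equivI_affine[of 1 1 0 0 1 _ 0 0]) simp_all

text \<open>A linear change of coordinates is constrained by the cubic form only; the lower
  coefficients are whatever results after division by c.\<close>

lemma aut_equiv_leading:
  assumes "a * e \<noteq> b * d" "c \<noteq> 0"
    "\<alpha> * a ^ 3 + \<beta> * a ^ 2 * d + \<gamma> * a * d ^ 2 = c * \<alpha>'"
    "3 * \<alpha> * a ^ 2 * b + \<beta> * (2 * a * b * d + a ^ 2 * e) + \<gamma> * (b * d ^ 2 + 2 * a * d * e) = c * \<beta>'"
    "3 * \<alpha> * a * b ^ 2 + \<beta> * (b ^ 2 * d + 2 * a * b * e) + \<gamma> * (a * e ^ 2 + 2 * b * d * e) = c * \<gamma>'"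
    "\<alpha> * b ^ 3 + \<beta> * b ^ 2 * e + \<gamma> * b * e ^ 2 = c * \<delta>'"
  shows "\<exists>A' B' C' H' I' J'. aut_equiv (cub \<alpha> \<beta> \<gamma> 0 A B C H I J) (cub \<alpha>' \<beta>' \<gamma>' \<delta>' A' B' C' H' I' J')"
proof -
  have c: "\<exists>z'. z = c * z'" for z using \<open>c \<noteq> 0\<close> by (metis nonzero_mult_div_cancel_left times_divide_eq_right)
  have "\<exists>A' B' C' H' I' J'. affine_coeffs a b 0 d e 0 c \<alpha> \<beta> \<gamma> A B C H I J \<alpha>' \<beta>' \<gamma>' \<delta>' A' B' C' H' I' J'"
    unfolding affine_coeffs_def using assms c by simp
  then obtain A' B' C' H' I' J'
    where "affine_coeffs a b 0 d e 0 c \<alpha> \<beta> \<gamma> A B C H I J \<alpha>' \<beta>' \<gamma>' \<delta>' A' B' C' H' I' J'" by blast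
  from aut_equivI_coeffs[OF this] show ?thesis by blast
qed

lemma aut_equiv_translate:
  "\<exists>H' I' J'. aut_equiv (cub \<alpha> \<beta> \<gamma> 0 A B C H I J)
    (cub \<alpha> \<beta> \<gamma> 0 (A + 3 * \<alpha> * p + \<beta> * q) (B + 2 * \<beta> * p + 2 * \<gamma> * q) (C + \<gamma> * p) H' I' J')"
proof -
  have "\<exists>H' I' J'. affine_coeffs 1 0 p 0 1 q 1 \<alpha> \<beta> \<gamma> A B C H I J \<alpha> \<beta> \<gamma> 0
      (A + 3 * \<alpha> * p + \<beta> * q) (B + 2 * \<beta> * p + 2 * \<gamma> * q) (C + \<gamma> * p) H' I' J'"
    by (simp add: affine_coeffs_def)
  then obtain H' I' J' where "affine_coeffs 1 0 p 0 1 q 1 \<alpha> \<beta> \<gamma> A B C H I J \<alpha> \<beta> \<gamma> 0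
      (A + 3 * \<alpha> * p + \<beta> * q) (B + 2 * \<beta> * p + 2 * \<gamma> * q) (C + \<gamma> * p) H' I' J'" by blast
  from aut_equivI_coeffs[OF this] show ?thesis by blast
qed

lemma aut_equiv_scale:
  assumes "a \<noteq> 0" "e \<noteq> 0" "c \<noteq> 0"
  shows "aut_equiv (cub \<alpha> \<beta> \<gamma> 0 A B C H I J)
    (cub (\<alpha> * a ^ 3 / c) (\<beta> * a ^ 2 * e / c) (\<gamma> * a * e ^ 2 / c) 0 (A * a ^ 2 / c) (B * a * e / c) (C * e ^ 2 / c)
      (H * a / c) (I * e / c) (J / c))"
  by (rule aut_equivI_coeffs[of a 0 0 0 e 0 c]) (simp add: affine_coeffs_def assms)

section \<open>Canonical cubic forms\<close>

lemma cubic_has_real_root: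
  fixes \<alpha> \<beta> \<gamma> \<delta> :: real
  assumes "\<delta> \<noteq> 0"
  shows "\<exists>t. \<alpha> + \<beta> * t + \<gamma> * t ^ 2 + \<delta> * t ^ 3 = 0"
proof -
  have pos: "\<exists>t. \<alpha> + \<beta> * t + \<gamma> * t ^ 2 + \<delta> * t ^ 3 = 0" if d: "0 < \<delta>" for \<alpha> \<beta> \<gamma> \<delta> :: real
  proof -
    obtain m where m: "\<And>x. m \<le> x \<Longrightarrow> \<delta> \<le> poly [:\<alpha>, \<beta>, \<gamma>, \<delta>:] x"
      using poly_pinfty_gt_lc[of "[:\<alpha>, \<beta>, \<gamma>, \<delta>:]"] d by auto
    \<comment> \<open>This polynomial is the negative of the original one at -x, so the same growth
      statement controls both ends.\<close>
    obtain n where n: "\<And>x. n \<le> x \<Longrightarrow> \<delta> \<le> poly [:- \<alpha>, \<beta>, - \<gamma>, \<delta>:] x"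
      using poly_pinfty_gt_lc[of "[:- \<alpha>, \<beta>, - \<gamma>, \<delta>:]"] d by auto
    define M where "M = max 1 (max m n)"
    have "poly [:- \<alpha>, \<beta>, - \<gamma>, \<delta>:] M = - poly [:\<alpha>, \<beta>, \<gamma>, \<delta>:] (- M)"
      by (simp add: algebra_simps)
    then have "poly [:\<alpha>, \<beta>, \<gamma>, \<delta>:] (- M) < 0" "0 < poly [:\<alpha>, \<beta>, \<gamma>, \<delta>:] M" "- M < M"
      using m[of M] n[of M] d unfolding M_def by linarith+
    then obtain t where "poly [:\<alpha>, \<beta>, \<gamma>, \<delta>:] t = 0" using poly_IVT_pos by blast
    then have "\<alpha> + \<beta> * t + \<gamma> * t ^ 2 + \<delta> * t ^ 3 = 0"
      by (simp add: algebra_simps power2_eq_square power3_eq_cube)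
    then show ?thesis ..
  qed
  show ?thesis
  proof (cases "0 < \<delta>")
    case True
    then show ?thesis by (rule pos)
  next
    case False
    then obtain t where "- \<alpha> + (- \<beta>) * t + (- \<gamma>) * t ^ 2 + (- \<delta>) * t ^ 3 = 0"
      using pos[of "- \<delta>" "- \<alpha>" "- \<beta>" "- \<gamma>"] assms by force
    then have "\<alpha> + \<beta> * t + \<gamma> * t ^ 2 + \<delta> * t ^ 3 = 0" by linarith
    then show ?thesis ..
  qed
qed

text \<open>The substitution sends the direction (0, 1) to (1, t), where the cubic form vanishes;
  the coefficient of y^3 thus becomes 0.\<close>

lemma aut_equiv_real_line:
  assumes "\<alpha> \<noteq> 0 \<or> \<beta> \<noteq> 0 \<or> \<gamma> \<noteq> 0 \<or> \<delta> \<noteq> 0"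
  shows "\<exists>\<alpha>' \<beta>' \<gamma>' A' B' C' H' I' J'. (\<alpha>' \<noteq> 0 \<or> \<beta>' \<noteq> 0 \<or> \<gamma>' \<noteq> 0) \<and>
    aut_equiv (cub \<alpha> \<beta> \<gamma> \<delta> A B C H I J) (cub \<alpha>' \<beta>' \<gamma>' 0 A' B' C' H' I' J')"
proof (cases "\<delta> = 0")
  case True
  then show ?thesis using assms aut_equiv_refl by blast
next
  case False
  obtain t where t: "\<alpha> + \<beta> * t + \<gamma> * t ^ 2 + \<delta> * t ^ 3 = 0" using cubic_has_real_root[OF False] by blast
  have "aut_equiv (cub \<alpha> \<beta> \<gamma> \<delta> A B C H I J) (cub \<delta> (\<gamma> + 3 * \<delta> * t) (\<beta> + 2 * \<gamma> * t + 3 * \<delta> * t ^ 2) 0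
      C (B + 2 * C * t) (A + B * t + C * t ^ 2) I (H + I * t) J)"
  proof (rule aut_equivI_affine[of 0 t 1 1 1 _ 0 0])
    fix x y
    have "ev (cub \<alpha> \<beta> \<gamma> \<delta> A B C H I J) (0 * x + 1 * y + 0) (1 * x + t * y + 0) =
        1 * ev (cub \<delta> (\<gamma> + 3 * \<delta> * t) (\<beta> + 2 * \<gamma> * t + 3 * \<delta> * t ^ 2)
      (\<alpha> + \<beta> * t + \<gamma> * t ^ 2 + \<delta> * t ^ 3) C (B + 2 * C * t) (A + B * t + C * t ^ 2) I (H + I * t) J) x y"
      unfolding ev_cub by algebra
    then show "ev (cub \<alpha> \<beta> \<gamma> \<delta> A B C H I J) (0 * x + 1 * y + 0) (1 * x + t * y + 0) =
        1 * ev (cub \<delta> (\<gamma> + 3 * \<delta> * t) (\<beta> + 2 * \<gamma> * t + 3 * \<delta> * t ^ 2) 0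
      C (B + 2 * C * t) (A + B * t + C * t ^ 2) I (H + I * t) J) x y"
      by (simp only: t)
  qed simp_all
  then show ?thesis using False by blast
qed

lemma aut_equiv_canonical_leading:
  assumes "\<alpha> \<noteq> 0 \<or> \<beta> \<noteq> 0 \<or> \<gamma> \<noteq> 0"
  shows "\<exists>\<alpha>' \<beta>' \<gamma>' A' B' C' H' I' J'. aut_equiv (cub \<alpha> \<beta> \<gamma> 0 A B C H I J) (cub \<alpha>' \<beta>' \<gamma>' 0 A' B' C' H' I' J') \<and>
    (\<alpha>', \<beta>', \<gamma>') \<in> {(1, 0, 1), (1, 0, -1), (0, 1, 0), (1, 0, 0)}"
proof -
  have canonical: ?thesis
    if "\<exists>A' B' C' H' I' J'. aut_equiv (cub \<alpha> \<beta> \<gamma> 0 A B C H I J) (cub a b g 0 A' B' C' H' I' J')"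
      "(a, b, g) \<in> {(1, 0, 1), (1, 0, -1), (0, 1, 0), (1, 0, 0)}" for a b g
    using that by blast
  consider "\<gamma> \<noteq> 0" "4 * \<alpha> * \<gamma> \<noteq> \<beta> ^ 2" | "\<gamma> \<noteq> 0" "4 * \<alpha> * \<gamma> = \<beta> ^ 2" | "\<gamma> = 0" "\<beta> \<noteq> 0" | "\<gamma> = 0" "\<beta> = 0" "\<alpha> \<noteq> 0"
    using assms by blast
  then show ?thesis
  proof cases
    case 1
    \<comment> \<open>Completing the square gives x (c x^2 + \<gamma> (y + \<beta> x /
      (2\<gamma>))^2). Scaling y by \<open>e\<close> turns \<gamma> into c or -c.\<close>
    define c where "c = \<alpha> - \<beta> ^ 2 / (4 * \<gamma>)"
    have c: "c \<noteq> 0" using 1 by (simp add: c_def field_simps)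
    define e where "e = sqrt \<bar>c / \<gamma>\<bar>"
    have e: "e \<noteq> 0" and e2: "e ^ 2 = \<bar>c / \<gamma>\<bar>" using c 1 by (simp_all add: e_def)
    define s where "s = sgn (c / \<gamma>)"
    have s: "s = 1 \<or> s = -1" using c 1 by (auto simp: s_def sgn_if)
    have "\<bar>c / \<gamma>\<bar> = c / \<gamma> * s" by (simp only: s_def abs_sgn)
    then have "\<gamma> * e ^ 2 = c * s" using e2 1 by simp
    then have "\<exists>A' B' C' H' I' J'. aut_equiv (cub \<alpha> \<beta> \<gamma> 0 A B C H I J) (cub 1 0 s 0 A' B' C' H' I' J')"
      using 1 c e
      by (intro aut_equiv_leading[of 1 e 0 "- \<beta> / (2 * \<gamma>)" c])
        (simp_all add: c_def field_simps power2_eq_square)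
    then show ?thesis by (rule canonical) (use s in auto)
  next
    case 2
    \<comment> \<open>The form is \<gamma> x (y + \<beta> x / (2\<gamma>))^2; the simple line is
      taken to y = 0 and the double one to x = 0.\<close>
    have "\<exists>A' B' C' H' I' J'. aut_equiv (cub \<alpha> \<beta> \<gamma> 0 A B C H I J) (cub 0 1 0 0 A' B' C' H' I' J')"
      using 2
      by (intro aut_equiv_leading[of 0 "- \<beta> / (2 * \<gamma>)" 1 1 \<gamma>])
        (simp_all add: field_simps power2_eq_square power3_eq_cube)
    then show ?thesis by (rule canonical) simp
  next
    case 3
    have "\<exists>A' B' C' H' I' J'. aut_equiv (cub \<alpha> \<beta> \<gamma> 0 A B C H I J) (cub 0 1 0 0 A' B' C' H' I' J')"
      using 3
      by (intro aut_equiv_leading[of 1 "1 / \<beta>" 0 "- \<alpha> / \<beta>" 1]) (simp_all add: field_simps)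
    then show ?thesis by (rule canonical) simp
  next
    case 4
    have "\<exists>A' B' C' H' I' J'. aut_equiv (cub \<alpha> \<beta> \<gamma> 0 A B C H I J) (cub 1 0 0 0 A' B' C' H' I' J')"
      using 4 by (intro aut_equiv_leading[of 1 1 0 0 \<alpha>]) simp_all
    then show ?thesis by (rule canonical) simp
  qed
qed

text \<open>Normalizing a coefficient of weight 2 fixes only a^2, so the sign of \<open>a\<close> is
  still available to make a coefficient of odd weight nonnegative.\<close>

lemma ex_square_root_sign:
  assumes "x \<noteq> 0"
  obtains a :: real where "a \<noteq> 0" "a ^ 2 = \<bar>x\<bar>" "0 \<le> K / a" "0 \<le> K / a ^ 3"
proof -
  define a where "a = (if 0 \<le> K then sqrt \<bar>x\<bar> else - sqrt \<bar>x\<bar>)"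
  have a: "a \<noteq> 0" "a ^ 2 = \<bar>x\<bar>" "0 \<le> K / a"
    using assms by (simp_all add: a_def divide_nonpos_pos)
  have "K / a ^ 3 = K / a / a ^ 2" by (simp add: power2_eq_square power3_eq_cube)
  also have "\<dots> \<ge> 0" by (intro divide_nonneg_nonneg a(3) zero_le_power2)
  finally show thesis using that a by blast
qed

section \<open>Normal forms for each leading form\<close>

lemma list_LI:
  "normal1 A H I J \<Longrightarrow> cub 1 0 1 0 A 0 0 H I J \<in> list_L1"
  "normal2 C H I J \<Longrightarrow> cub 1 0 (-1) 0 0 0 C H I J \<in> list_L2"
  "normal3 C H I J \<Longrightarrow> cub 0 1 0 0 0 0 C H I J \<in> list_L3"
  "normal4 B C H I J \<Longrightarrow> cub 1 0 0 0 0 B C H I J \<in> list_L4"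
  unfolding list_L1_iff list_L2_iff list_L3_iff list_L4_iff cub_inject by simp_all

lemma ex_normal1:
  "\<exists>g\<in>list_L1. aut_equiv (cub 1 0 1 0 A B C H I J) g"
proof -
  \<comment> \<open>The translation clears the y^2 and xy terms.\<close>
  obtain H1 I1 J1 where 1: "aut_equiv (cub 1 0 1 0 A B C H I J) (cub 1 0 1 0 (A - 3 * C) 0 0 H1 I1 J1)"
    using aut_equiv_translate[of 1 0 1 A B C H I J "- C" "- B / 2"] by auto
  define A1 where "A1 = A - 3 * C"
  have scale: "aut_equiv (cub 1 0 1 0 A1 0 0 H1 I1 J1) (cub 1 0 1 0 (A1 / a) 0 0 (H1 / a ^ 2) (s * I1 / a ^ 2) (J1 / a ^ 3))"
    if "a \<noteq> 0" "s = 1 \<or> s = -1" for a s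
    using aut_equiv_scale[of a "s * a" "a ^ 3" 1 0 1 A1 0 0 H1 I1 J1] that
    by (auto simp: power2_eq_square power3_eq_cube)
  obtain s where s: "s = 1 \<or> s = (-1::real)" "s * I1 = \<bar>I1\<bar>" by (metis abs_if mult_1 mult_minus1)
  have "\<exists>a. a \<noteq> 0 \<and> normal1 (A1 / a) (H1 / a ^ 2) (s * I1 / a ^ 2) (J1 / a ^ 3)"
  proof (cases "A1 = 0")
    case False
    then show ?thesis using s by (intro exI[of _ A1]) (simp add: normal1_def)
  next
    case A1: True
    show ?thesis
    proof (cases "I1 = 0 \<and> H1 = 0")
      case True
      show ?thesis
      proof (cases "J1 = 0")
        case True
        then show ?thesis using A1 \<open>I1 = 0 \<and> H1 = 0\<close> by (intro exI[of _ 1]) (simp add: normal1_def)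
      next
        case False
        then have "root 3 J1 \<noteq> 0" "root 3 J1 ^ 3 = J1" by (simp_all add: odd_real_root_pow)
        then show ?thesis using A1 True False by (intro exI[of _ "root 3 J1"]) (simp add: normal1_def)
      qed
    next
      case False
      \<comment> \<open>\<open>I1\<close> takes precedence: if it is nonzero it becomes 1 and
        \<open>H\<close> stays free; otherwise \<open>H1\<close> becomes 1 or -1.\<close>
      define x where "x = (if I1 = 0 then H1 else I1)"
      have "x \<noteq> 0" using False by (simp add: x_def)
      then obtain a where "a \<noteq> 0" "a ^ 2 = \<bar>x\<bar>" "0 \<le> J1 / a ^ 3" by (rule ex_square_root_sign)
      then show ?thesis using A1 s False
        by (intro exI[of _ a]) (auto simp: normal1_def x_def abs_if split: if_splits)
    qed
  qed
  then obtain a where "a \<noteq> 0" and n: "normal1 (A1 / a) (H1 / a ^ 2) (s * I1 / a ^ 2) (J1 / a ^ 3)" by blast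
  show ?thesis
    using aut_equiv_trans[OF 1[folded A1_def] scale[OF \<open>a \<noteq> 0\<close> s(1)]] list_LI(1)[OF n] by blast
qed

lemma ex_normal2:
  "\<exists>g\<in>list_L2. aut_equiv (cub 1 0 (-1) 0 A B C H I J) g"
proof -
  obtain H1 I1 J1 where 1: "aut_equiv (cub 1 0 (-1) 0 A B C H I J) (cub 1 0 (-1) 0 0 0 (C + A / 3) H1 I1 J1)"
    using aut_equiv_translate[of 1 0 "-1" A B C H I J "- A / 3" "B / 2"] by auto
  define C1 where "C1 = C + A / 3"
  let ?f = "\<lambda>C H I J. cub 1 0 (-1) 0 0 0 C H I J"
  have scale: "aut_equiv (?f C H I J) (?f (C / a) (H / a ^ 2) (I / a ^ 2) (J / a ^ 3))"
    if "a \<noteq> 0" for a C H I J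
    using aut_equiv_scale[of a a "a ^ 3" 1 0 "-1" 0 0 C H I J] that
    by (simp add: power2_eq_square power3_eq_cube)
  have flip: "aut_equiv (?f C H I J) (?f C H (- I) J)" for C H I J
    using aut_equiv_scale[of 1 "-1" 1 1 0 "-1" 0 0 C H I J] by simp
  show ?thesis
  proof (cases "C1 = 0")
    case False
    let ?g = "\<lambda>H I J. ?f (-1) H I J"
    \<comment> \<open>The linear part exchanges the lines x = 0 and x = y and keeps x = -y. The
      translation (-3/4, 3/4) restores the quadratic part -y^2, and the constant is the value of the
      cubic at that vector.\<close>
    have reflect: "\<exists>J'. aut_equiv (?g H I J) (?g (- (9 / 4 + H - 3 * I) / 2) ((3 / 4 + H + I) / 2) J')" for H I J
      by (rule exI[of _ "J + (12 * I - 9 - 12 * H) / 16"], rule aut_equivI_coeffs[of "-1/2" "1/2" "-3/4" "3/2" "1/2" "3/4" 1])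
        (simp add: affine_coeffs_def field_simps power2_eq_square power3_eq_cube)
    define H2 I2 J2 where "H2 = H1 / C1 ^ 2" "I2 = I1 / C1 ^ 2" "J2 = - J1 / C1 ^ 3"
    have 2: "aut_equiv (?f C1 H1 I1 J1) (?g H2 I2 J2)"
      using scale[of "- C1" C1 H1 I1 J1] False by (simp add: H2_I2_J2_def)
    have "\<exists>H3 I3 J3. aut_equiv (?g H I J) (?g H3 I3 J3) \<and> 0 \<le> I3 \<and> H3 + I3 \<le> - 3 / 4" if "0 \<le> I" for H I J
    proof -
      obtain J' where r: "aut_equiv (?g H I J) (?g (- (9 / 4 + H + 3 * I) / 2) ((3 / 4 + H - I) / 2) J')"
        using reflect[of H "- I" J] aut_equiv_trans[OF flip] by force
      \<comment> \<open>The walls H + 3/4 = \<plusminus> I cut the half-plane 0 \<le> I into three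
        chambers. The rotation \<open>r\<close>, followed by \<open>flip\<close> in the last case,
        carries the other two into the chosen one.\<close>
      consider "H + I \<le> - 3 / 4" | "- 3 / 4 \<le> H + I" "I \<le> 3 / 4 + H" | "- 3 / 4 \<le> H + I" "3 / 4 + H \<le> I"
        by linarith
      then show ?thesis
      proof cases
        case 1
        then show ?thesis using aut_equiv_refl that by blast
      next
        case 2
        have "0 \<le> (3 / 4 + H - I) / 2" "- (9 / 4 + H + 3 * I) / 2 + (3 / 4 + H - I) / 2 \<le> - 3 / 4"
          using 2 that by (simp_all add: field_simps)
        then show ?thesis using r by blast
      next
        case 3
        have "0 \<le> - ((3 / 4 + H - I) / 2)" "- (9 / 4 + H + 3 * I) / 2 + - ((3 / 4 + H - I) / 2) \<le> - 3 / 4"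
          using 3 that by (simp_all add: field_simps)
        then show ?thesis using aut_equiv_trans[OF r flip] by blast
      qed
    qed
    from this[of "\<bar>I2\<bar>" H2 J2] obtain H3 I3 J3
      where 3: "aut_equiv (?g H2 \<bar>I2\<bar> J2) (?g H3 I3 J3)" "0 \<le> I3 \<and> H3 + I3 \<le> - 3 / 4" by auto
    have "aut_equiv (?f C1 H1 I1 J1) (?g H2 \<bar>I2\<bar> J2)"
      using 2 aut_equiv_trans[OF 2 flip] by (cases "0 \<le> I2") simp_all
    then have "aut_equiv (cub 1 0 (-1) 0 A B C H I J) (?g H3 I3 J3)"
      using aut_equiv_trans[OF 1[folded C1_def]] aut_equiv_trans[OF _ 3(1)] by blast
    moreover have "normal2 (-1) H3 I3 J3" using 3(2) by (simp add: normal2_def)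
    ultimately show ?thesis using list_LI(2) by blast
  next
    case C1: True
    let ?g = "\<lambda>H I J. ?f 0 H I J"
    have 1: "aut_equiv (cub 1 0 (-1) 0 A B C H I J) (?g H1 I1 J1)" using 1 C1 C1_def by simp
    have reflect: "aut_equiv (?g H I J) (?g (- (H - 3 * I) / 2) ((H + I) / 2) J)" for H I J
      by (rule aut_equivI_coeffs[of "-1/2" "1/2" 0 "3/2" "1/2" 0 1])
        (simp add: affine_coeffs_def field_simps power2_eq_square power3_eq_cube)
    show ?thesis
    proof (cases "H1 = 0 \<and> I1 = 0")
      case True
      define a where "a = (if J1 = 0 then 1 else root 3 J1)"
      have "a \<noteq> 0" by (simp add: a_def)
      moreover have "normal2 0 (H1 / a ^ 2) (I1 / a ^ 2) (J1 / a ^ 3)"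
        using True by (simp add: normal2_def a_def odd_real_root_pow)
      ultimately show ?thesis
        using aut_equiv_trans[OF 1 scale[of a 0 H1 I1 J1]] list_LI(2)[of 0] by auto
    next
      case False
      \<comment> \<open>The three sectors of the lower half-plane are moved to the middle one. There
        \<open>I3\<close> is negative and dominates \<open>H3\<close>, so scaling \<open>I3\<close>
        to -1 puts \<open>H\<close> into [-1, 1].\<close>
      have cone: "\<exists>H3 I3. aut_equiv (?g H I J) (?g H3 I3 J) \<and> I3 < 0 \<and> \<bar>H3\<bar> \<le> - I3"
        if "I \<le> 0" "H \<noteq> 0 \<or> I \<noteq> 0" for H I J
      proof -
        consider "\<bar>H\<bar> \<le> - I" | "- I < H" | "H < I" using that by linarith
        then show ?thesis
        proof cases
          case 1
          then show ?thesis using that aut_equiv_refl[of "?g H I J"] by (intro exI[of _ H] exI[of _ I]) auto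
        next
          case 2
          have "aut_equiv (?g H I J) (?g (- (H + 3 * I) / 2) (- ((H - I) / 2)) J)"
            using aut_equiv_trans[OF aut_equiv_trans[OF flip[of 0 H I J] reflect] flip] by simp
          moreover have "- ((H - I) / 2) < 0" "\<bar>- (H + 3 * I) / 2\<bar> \<le> - (- ((H - I) / 2))"
            using 2 that by (simp_all add: abs_le_iff field_simps)
          ultimately show ?thesis by blast
        next
          case 3
          have "(H + I) / 2 < 0" "\<bar>- (H - 3 * I) / 2\<bar> \<le> - ((H + I) / 2)"
            using 3 that by (simp_all add: abs_le_iff field_simps)
          then show ?thesis using reflect by blast
        qed
      qed
      have 2: "aut_equiv (cub 1 0 (-1) 0 A B C H I J) (?g H1 (- \<bar>I1\<bar>) J1)"
        using 1 aut_equiv_trans[OF 1 flip] by (cases "0 \<le> I1") simp_all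
      obtain H3 I3 where 3: "aut_equiv (?g H1 (- \<bar>I1\<bar>) J1) (?g H3 I3 J1)" "I3 < 0" "\<bar>H3\<bar> \<le> - I3"
        using cone[of "- \<bar>I1\<bar>" H1 J1] False by auto
      note 4 = aut_equiv_trans[OF 2 3(1)]
      have "I3 \<le> H3" "H3 \<le> - I3" using 3(3) by linarith+
      have "I3 \<noteq> 0" using 3(2) by simp
      then obtain a where a: "a \<noteq> 0" "a ^ 2 = \<bar>I3\<bar>" "0 \<le> J1 / a ^ 3" by (rule ex_square_root_sign)
      have "normal2 0 (H3 / a ^ 2) (I3 / a ^ 2) (J1 / a ^ 3)"
        using a 3(2) \<open>I3 \<le> H3\<close> \<open>H3 \<le> - I3\<close> by (simp add: normal2_def field_simps)
      then show ?thesis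
        using aut_equiv_trans[OF 4 scale[OF a(1)]] list_LI(2)[of 0] by auto
    qed
  qed
qed

lemma ex_normal3:
  "\<exists>g\<in>list_L3. aut_equiv (cub 0 1 0 0 A B C H I J) g"
proof -
  obtain H1 I1 J1 where 1: "aut_equiv (cub 0 1 0 0 A B C H I J) (cub 0 1 0 0 0 0 C H1 I1 J1)"
    using aut_equiv_translate[of 0 1 0 A B C H I J "- B / 2" "- A"] by auto
  have scale: "aut_equiv (cub 0 1 0 0 0 0 C H1 I1 J1)
      (cub 0 1 0 0 0 0 (C * e / a ^ 2) (H1 / (a * e)) (I1 / a ^ 2) (J1 / (a ^ 2 * e)))"
    if "a \<noteq> 0" "e \<noteq> 0" for a e
    using aut_equiv_scale[of a e "a ^ 2 * e" 0 1 0 0 0 C H1 I1 J1] that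
    by (simp add: power2_eq_square)
  have "\<exists>a e. a \<noteq> 0 \<and> e \<noteq> 0 \<and> normal3 (C * e / a ^ 2) (H1 / (a * e)) (I1 / a ^ 2) (J1 / (a ^ 2 * e))"
  proof (cases "C = 0")
    case False
    \<comment> \<open>With e = a^2 / C the coefficient of y^2 becomes 1, and \<open>a\<close> is
      left to normalize the first nonzero one among \<open>H1\<close>, \<open>I1\<close>,
      \<open>J1\<close>.\<close>
    have e: "\<exists>a e. a \<noteq> 0 \<and> e \<noteq> 0 \<and> normal3 (C * e / a ^ 2) (H1 / (a * e)) (I1 / a ^ 2) (J1 / (a ^ 2 * e))"
      if "a \<noteq> 0" "normal3 1 (H1 * C / a ^ 3) (I1 / a ^ 2) (J1 * C / a ^ 4)" for a
    proof -
      have eqs: "C * (a ^ 2 / C) / a ^ 2 = 1" "H1 / (a * (a ^ 2 / C)) = H1 * C / a ^ 3"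
        "J1 / (a ^ 2 * (a ^ 2 / C)) = J1 * C / a ^ 4"
        using that(1) False by (simp_all add: power_numeral_reduce)
      have "normal3 (C * (a ^ 2 / C) / a ^ 2) (H1 / (a * (a ^ 2 / C))) (I1 / a ^ 2) (J1 / (a ^ 2 * (a ^ 2 / C)))"
        using that(2) by (simp only: eqs)
      moreover have "a ^ 2 / C \<noteq> 0" using that(1) False by simp
      ultimately show ?thesis using that(1) by blast
    qed
    show ?thesis
    proof (cases "H1 = 0")
      case H1: False
      then have "root 3 (- H1 * C) \<noteq> 0" "root 3 (- H1 * C) ^ 3 = - H1 * C"
        using False by (simp_all add: odd_real_root_pow)
      then show ?thesis using H1 False by (intro e[of "root 3 (- H1 * C)"]) (simp_all add: normal3_def)
    next
      case H1: True
      show ?thesis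
      proof (cases "I1 = 0")
        case I1: False
        then show ?thesis using H1
          by (intro e[of "sqrt \<bar>I1\<bar>"]) (simp_all add: normal3_def abs_if)
      next
        case I1: True
        show ?thesis
        proof (cases "J1 = 0")
          case True
          then show ?thesis using H1 I1 by (intro e[of 1]) (simp_all add: normal3_def)
        next
          case J1: False
          then have "root 4 \<bar>J1 * C\<bar> \<noteq> 0" "root 4 \<bar>J1 * C\<bar> ^ 4 = \<bar>J1 * C\<bar>"
            using False by simp_all
          then show ?thesis using H1 I1 J1 False
            by (intro e[of "root 4 \<bar>J1 * C\<bar>"]) (auto simp: normal3_def abs_if)
        qed
      qed
    qed
  next
    case C: True
    consider "H1 \<noteq> 0" "I1 \<noteq> 0" | "H1 \<noteq> 0" "I1 = 0" "J1 \<noteq> 0" | "H1 \<noteq> 0" "I1 = 0" "J1 = 0"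
      | "H1 = 0" "I1 \<noteq> 0" | "H1 = 0" "I1 = 0" by blast
    then show ?thesis
    proof cases
      case 1
      \<comment> \<open>\<open>I1\<close> fixes a^2 and e = -H1 / a makes the coefficient of x equal
        to -1; the sign of \<open>a\<close> then adjusts the constant.\<close>
      obtain a where a: "a \<noteq> 0" "a ^ 2 = \<bar>I1\<bar>" "0 \<le> (- J1 / H1) / a"
        using ex_square_root_sign[OF 1(2), of "- J1 / H1"] by blast
      have "J1 / (a ^ 2 * (- H1 / a)) = (- J1 / H1) / a" using a 1 by (simp add: field_simps power2_eq_square)
      then have "normal3 0 (- 1) (I1 / a ^ 2) (J1 / (a ^ 2 * (- H1 / a)))"
        unfolding normal3_def using a 1 by (simp add: abs_if)
      then show ?thesis using a 1 C by (intro exI[of _ a] exI[of _ "- H1 / a"]) simp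
    next
      case 2
      \<comment> \<open>These witnesses solve a e = -H1 and a^2 e = J1.\<close>
      then show ?thesis using C
        by (intro exI[of _ "- J1 / H1"] exI[of _ "H1 ^ 2 / J1"]) (simp add: normal3_def field_simps power2_eq_square)
    next
      case 3
      then show ?thesis using C by (intro exI[of _ 1] exI[of _ "- H1"]) (simp add: normal3_def)
    next
      case 4
      then show ?thesis using C
        by (intro exI[of _ "sqrt \<bar>I1\<bar>"] exI[of _ "if J1 = 0 then 1 else J1 / \<bar>I1\<bar>"])
          (simp add: normal3_def abs_if)
    next
      case 5
      then show ?thesis using C
        by (intro exI[of _ 1] exI[of _ "if J1 = 0 then 1 else - J1"]) (simp add: normal3_def)
    qed
  qed
  then obtain a e where ae: "a \<noteq> 0" "e \<noteq> 0"
    and n: "normal3 (C * e / a ^ 2) (H1 / (a * e)) (I1 / a ^ 2) (J1 / (a ^ 2 * e))" by blast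
  show ?thesis
    using aut_equiv_trans[OF 1 scale[OF ae]] list_LI(3)[OF n] by blast
qed

lemma ex_weierstrass:
  assumes C: "C \<noteq> 0"
  shows "\<exists>g\<in>list_L4. aut_equiv (cub 1 0 0 0 A B C H I J) g"
proof -
  \<comment> \<open>The shear y -> y + d x removes the xy term; then \<open>p\<close> removes x^2
    and \<open>q\<close> removes y.\<close>
  define d where "d = - B / (2 * C)"
  define p where "p = - (A + B * d + C * d ^ 2) / 3"
  define q where "q = - (B * p + I) / (2 * C)"
  have d: "B + 2 * C * d = 0" using C by (simp add: d_def)
  have p: "3 * p + A + B * d + C * d ^ 2 = 0" by (simp add: p_def field_simps)
  have q: "B * p + 2 * C * q + I = 0" using C by (simp add: q_def)
  have "\<exists>H1 J1. affine_coeffs 1 0 p d 1 q 1 1 0 0 A B C H I J 1 0 0 0 0 0 C H1 0 J1"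
    unfolding affine_coeffs_def using d p q by simp
  then obtain H1 J1 where "affine_coeffs 1 0 p d 1 q 1 1 0 0 A B C H I J 1 0 0 0 0 0 C H1 0 J1" by blast
  note 1 = aut_equivI_coeffs[OF this]
  define H2 J2 where "H2 = H1 / C ^ 2" "J2 = J1 / - (C ^ 3)"
  have 2: "aut_equiv (cub 1 0 0 0 0 0 C H1 0 J1) (cub 1 0 0 0 0 0 (-1) H2 0 J2)"
    using aut_equiv_scale[of "- C" C "- (C ^ 3)" 1 0 0 0 0 C H1 0 J1] C
    by (simp add: H2_J2_def power2_eq_square power3_eq_cube)
  \<comment> \<open>The classical scaling by (s^2, s^3), under which the coefficients have weights 4
    and 6.\<close>
  have 3: "aut_equiv (cub 1 0 0 0 0 0 (-1) H2 0 J2) (cub 1 0 0 0 0 0 (-1) (H2 / s ^ 4) 0 (J2 / s ^ 6))"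
    if "s \<noteq> 0" for s
    using aut_equiv_scale[of "s ^ 2" "s ^ 3" "s ^ 6" 1 0 0 0 0 "-1" H2 0 J2] that
    by (simp add: power_mult[symmetric]) (simp add: power_numeral_reduce)
  have "\<exists>s. s \<noteq> 0 \<and> weierstrass 0 (-1) (H2 / s ^ 4) 0 (J2 / s ^ 6)"
  proof (cases "H2 = 0")
    case False
    then have "root 4 \<bar>H2\<bar> \<noteq> 0" "root 4 \<bar>H2\<bar> ^ 4 = \<bar>H2\<bar>" by simp_all
    then show ?thesis using False
      by (intro exI[of _ "root 4 \<bar>H2\<bar>"]) (simp add: weierstrass_def abs_if)
  next
    case H2: True
    show ?thesis
    proof (cases "J2 = 0")
      case True
      then show ?thesis using H2 by (intro exI[of _ 1]) (simp add: weierstrass_def)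
    next
      case False
      then have "root 6 \<bar>J2\<bar> \<noteq> 0" "root 6 \<bar>J2\<bar> ^ 6 = \<bar>J2\<bar>" by simp_all
      then show ?thesis using False H2
        by (intro exI[of _ "root 6 \<bar>J2\<bar>"]) (auto simp: weierstrass_def abs_if)
    qed
  qed
  then obtain s where s: "s \<noteq> 0" "normal4 0 (-1) (H2 / s ^ 4) 0 (J2 / s ^ 6)" unfolding normal4_def by blast
  show ?thesis
    using aut_equiv_trans[OF aut_equiv_trans[OF 1 2] 3[OF s(1)]] list_LI(4)[OF s(2)] by blast
qed

lemma ex_y_linear:
  assumes C: "C = 0" and BI: "B \<noteq> 0 \<or> I \<noteq> 0"
  shows "\<exists>g\<in>list_L4. aut_equiv (cub 1 0 0 0 A B C H I J) g"
proof (cases "B = 0")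
  case B: True
  then have I: "I \<noteq> 0" using BI by simp
  \<comment> \<open>Here \<open>p\<close>, \<open>d\<close> and \<open>q\<close> clear the terms
    x^2, x and 1 in turn.\<close>
  define p where "p = - A / 3"
  define d where "d = - (3 * p ^ 2 + 2 * A * p + H) / I"
  define q where "q = - (p ^ 3 + A * p ^ 2 + H * p + J) / I"
  have "3 * p + A = 0" by (simp add: p_def)
  moreover have "3 * p ^ 2 + 2 * A * p + H + I * d = 0" using I by (simp add: d_def)
  moreover have "p ^ 3 + A * p ^ 2 + H * p + I * q + J = 0" using I by (simp add: q_def)
  ultimately have "affine_coeffs 1 0 p d (- 1 / I) q 1 1 0 0 A B C H I J 1 0 0 0 0 0 0 0 (-1) 0"
    using B C I by (simp add: affine_coeffs_def)
  from aut_equivI_coeffs[OF this] show ?thesis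
    using list_LI(4)[of 0 0 0 "-1" 0] by (auto simp: normal4_def y_linear_def)
next
  case B: False
  \<comment> \<open>Here \<open>p\<close>, \<open>d\<close> and \<open>q\<close> clear the terms y,
    x^2 and x in turn; the constant is out of reach and is scaled afterwards.\<close>
  define p where "p = - I / B"
  define d where "d = - (3 * p + A) / B"
  define q where "q = - (3 * p ^ 2 + 2 * A * p + B * d * p + H + I * d) / B"
  have "3 * p + A + B * d = 0" using B by (simp add: d_def)
  moreover have "3 * p ^ 2 + 2 * A * p + B * (q + d * p) + H + I * d = 0"
    using B by (simp add: q_def distrib_left mult_ac)
  moreover have "B * (- 1 / B * p) + I * (- 1 / B) = 0" using B by (simp add: p_def)
  ultimately have "\<exists>J1. affine_coeffs 1 0 p d (- 1 / B) q 1 1 0 0 A B C H I J 1 0 0 0 0 (-1) 0 0 0 J1"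
    using B C by (simp add: affine_coeffs_def)
  then obtain J1 where "affine_coeffs 1 0 p d (- 1 / B) q 1 1 0 0 A B C H I J 1 0 0 0 0 (-1) 0 0 0 J1" by blast
  note 1 = aut_equivI_coeffs[OF this]
  define a where "a = (if J1 = 0 then 1 else root 3 J1)"
  have a: "a \<noteq> 0" by (simp add: a_def)
  have 2: "aut_equiv (cub 1 0 0 0 0 (-1) 0 0 0 J1) (cub 1 0 0 0 0 (-1) 0 0 0 (J1 / a ^ 3))"
    using aut_equiv_scale[of a "a ^ 2" "a ^ 3" 1 0 0 0 "-1" 0 0 0 J1] a
    by (simp add: power2_eq_square power3_eq_cube)
  have "normal4 (-1) 0 0 0 (J1 / a ^ 3)"
    by (simp add: normal4_def y_linear_def a_def odd_real_root_pow)
  then show ?thesis using aut_equiv_trans[OF 1 2] list_LI(4) by blast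
qed

lemma ex_univariate:
  assumes "B = 0" "C = 0" "I = 0"
  shows "\<exists>g\<in>list_L4. aut_equiv (cub 1 0 0 0 A B C H I J) g"
proof -
  have "\<exists>H1 J1. affine_coeffs 1 0 (- A / 3) 0 1 0 1 1 0 0 A B C H I J 1 0 0 0 0 0 0 H1 0 J1"
    using assms by (simp add: affine_coeffs_def)
  then obtain H1 J1
    where "affine_coeffs 1 0 (- A / 3) 0 1 0 1 1 0 0 A B C H I J 1 0 0 0 0 0 0 H1 0 J1" by blast
  note 1 = aut_equivI_coeffs[OF this]
  have scale: "aut_equiv (cub 1 0 0 0 0 0 0 H1 0 J1) (cub 1 0 0 0 0 0 0 (H1 / a ^ 2) 0 (J1 / a ^ 3))"
    if "a \<noteq> 0" for a
    using aut_equiv_scale[of a 1 "a ^ 3" 1 0 0 0 0 0 H1 0 J1] that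
    by (simp add: power2_eq_square power3_eq_cube)
  have "\<exists>a. a \<noteq> 0 \<and> univariate 0 0 (H1 / a ^ 2) 0 (J1 / a ^ 3)"
  proof (cases "H1 = 0")
    case True
    then show ?thesis
      by (intro exI[of _ "if J1 = 0 then 1 else root 3 J1"]) (simp add: univariate_def odd_real_root_pow)
  next
    case False
    then obtain a where "a \<noteq> 0" "a ^ 2 = \<bar>H1\<bar>" "0 \<le> J1 / a ^ 3" by (rule ex_square_root_sign)
    then show ?thesis using False by (intro exI[of _ a]) (simp add: univariate_def abs_if)
  qed
  then obtain a where a: "a \<noteq> 0" "normal4 0 0 (H1 / a ^ 2) 0 (J1 / a ^ 3)" unfolding normal4_def by blast
  show ?thesis using aut_equiv_trans[OF 1 scale[OF a(1)]] list_LI(4)[OF a(2)] by blast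
qed

lemma ex_normal4:
  "\<exists>g\<in>list_L4. aut_equiv (cub 1 0 0 0 A B C H I J) g"
  using ex_weierstrass[of C A B H I J] ex_y_linear[of C B I A H J] ex_univariate[of B C I A H J] by blast

theorem theorem2p10:
  shows "(\<forall>f::bipoly. total_degree f = 3 \<longrightarrow> (\<exists>g\<in>list_L. aut_equiv f g)) \<and>
         (\<forall>f\<in>list_L. \<forall>g\<in>list_L. f \<noteq> g \<longrightarrow> \<not> aut_equiv f g)"
proof (intro conjI allI impI ballI notI)
  fix f :: bipoly assume "total_degree f = 3"
  then obtain a b c d A B C H I J where f: "f = cub a b c d A B C H I J"
    using total_degree_le_3D[of f] by auto
  have "a \<noteq> 0 \<or> b \<noteq> 0 \<or> c \<noteq> 0 \<or> d \<noteq> 0"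
    using \<open>total_degree f = 3\<close> total_degree_cub_no_leading[of A B C H I J] unfolding f by force
  from aut_equiv_real_line[OF this, of A B C H I J]
  obtain a1 b1 c1 A1 B1 C1 H1 I1 J1 where nz: "a1 \<noteq> 0 \<or> b1 \<noteq> 0 \<or> c1 \<noteq> 0"
    and 1: "aut_equiv f (cub a1 b1 c1 0 A1 B1 C1 H1 I1 J1)"
    unfolding f by blast
  from aut_equiv_canonical_leading[OF nz, of A1 B1 C1 H1 I1 J1]
  obtain a2 b2 c2 A2 B2 C2 H2 I2 J2
    where 2: "aut_equiv (cub a1 b1 c1 0 A1 B1 C1 H1 I1 J1) (cub a2 b2 c2 0 A2 B2 C2 H2 I2 J2)"
      and abc: "(a2, b2, c2) \<in> {(1, 0, 1), (1, 0, -1), (0, 1, 0), (1, 0, 0)}"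
    by blast
  have "\<exists>g\<in>list_L1 \<union> list_L2 \<union> list_L3 \<union> list_L4. aut_equiv (cub a2 b2 c2 0 A2 B2 C2 H2 I2 J2) g"
    using abc ex_normal1[of A2 B2 C2 H2 I2 J2] ex_normal2[of A2 B2 C2 H2 I2 J2]
      ex_normal3[of A2 B2 C2 H2 I2 J2] ex_normal4[of A2 B2 C2 H2 I2 J2]
    by (elim insertE emptyE) (simp_all add: bex_Un)
  then have "\<exists>g\<in>list_L. aut_equiv (cub a2 b2 c2 0 A2 B2 C2 H2 I2 J2) g"
    unfolding list_L_def .
  then show "\<exists>g\<in>list_L. aut_equiv f g" using aut_equiv_trans[OF aut_equiv_trans[OF 1 2]] by blast
next
  fix f g :: bipoly assume "f \<in> list_L" "g \<in> list_L" "f \<noteq> g" "aut_equiv f g"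
  then show False using list_L_unique by blast
qed

end
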